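(* In the setting of the context, let $f\in L^2(\Omega)$, $F(v):=\int_\Omega fv\,dx$, $X_h:=S^1_0(\mathcal T)\times P_0(\mathcal E)$ and $Y_h:=P_1(\mathcal T)$. Consider the mixed problem: find $(u_h,t_h)\in X_h$ and $v_h\in Y_h$ with $$a(v_h,\eta_h)+b(u_h,t_h;\eta_h)=F(\eta_h)\ \ \forall \eta_h\in Y_h,\qquad b'(u_h,t_h;w_h,s_h,v_h)=0\ \ \forall (w_h,s_h)\in X_h,\tag{M}$$ and the reduced problem: find $(u_h,v_h)\in S^1_0(\mathcal T)\times CR^1_0(\mathcal T)$ with $$a(v_h,w_{CR})+\int_\Omega\sigma(\nabla u_h)\cdot\nabla_{NC}w_{CR}\,dx=\int_\Omega f w_{CR}\,dx\ \ \forall w_{CR}\in CR^1_0(\mathcal T),$$ $$\int_\Omega\nabla w_C\cdot\big(\mathrm{D}\sigma(\nabla u_h)\nabla_{NC}v_h\big)\,dx=0\ \ \forall w_C\in S^1_0(\mathcal T).\tag{R}$$ (a) If $(u_h,t_h;v_h)\in X_h\times Y_h$ solves (M), then $v_h\in CR^1_0(\mathcal T)$ and $(u_h,v_h)$ solves (R). (b) For any solution $(u_h,v_h)\in S^1_0(\mathcal T)\times CR^1_0(\mathcal T)$ to (R), there exists a unique $t_h\in P_0(\mathcal E)$ such that $(u_h,t_h;v_h)$ solves (M).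
   Context: $\Omega\subset\mathbb R^n$ is a bounded Lipschitz domain with polyhedral boundary, $\mathcal T$ a regular (conforming) triangulation of $\Omega$ into $n$-simplices, $\mathcal E$ the set of all sides ($(n-1)$-dimensional faces) of $\mathcal T$, $\mathcal E(T)$ the sides of $T\in\mathcal T$, $\nu_T$ the outer unit normal of $T$. Each side $E$ has a globally fixed unit normal $\nu_E$ (equal to $\nu_T|_E$ for one of the simplices $T$ containing $E$). $\mathrm{mid}(E)$ is the barycenter of $E$. Nonlinearity: $\phi:[0,\infty)\to\mathbb R$ is continuous, $\phi\in C^2(0,\infty)$, and with constants $0<\gamma_1\le\gamma_2$: $\gamma_1\le\phi(t)\le\gamma_2$ and $\gamma_1\le\phi(t)+t\phi'(t)\le\gamma_2$; $\sigma(A):=\phi(|A|)A$ for $A\in\mathbb R^n$, and $\sigma\in C^1(\mathbb R^n;\mathbb R^n)$ with derivative $\mathrm D\sigma(A)=\phi(|A|)I+\phi'(|A|)|A|\,\tfrac{A}{|A|}\otimes\tfrac{A}{|A|}$ for $A\neq0$, $\mathrm D\sigma(0)=\phi(0)I$. Spaces: $P_k(\mathcal T)$ = piecewise polynomials of degree $\le k$; $S^1_0(\mathcal T)=P_1(\mathcal T)\cap H^1_0(\Omega)$; $P_0(\mathcal E)$ = functions on the skeleton constant on each side; $CR^1_0(\mathcal T)$ = $v\in P_1(\mathcal T)$ continuous at $\mathrm{mid}(E)$ for all interior sides $E$ and zero at $\mathrm{mid}(E)$ for all boundary sides. $H^1(\mathcal T)$ = piecewise $H^1$ functions, $\nabla_{NC}$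 the piecewise gradient. Forms: $a(v,w)=\int_\Omega(vw+\nabla_{NC}v\cdot\nabla_{NC}w)\,dx$ on $H^1(\mathcal T)$. For $t\in P_0(\mathcal E)$, $v\in H^1(\mathcal T)$: $\langle t,v\rangle_{\partial\mathcal T}=\sum_{T\in\mathcal T}\sum_{E\in\mathcal E(T)}(\nu_T\cdot\nu_E)\int_E t\,v|_T\,ds$. Further $b(u,t;v)=\int_\Omega\sigma(\nabla u)\cdot\nabla_{NC}v\,dx-\langle t,v\rangle_{\partial\mathcal T}$ and $b'(u,t;w,s,v)=\int_\Omega\nabla w\cdot(\mathrm D\sigma(\nabla u)\nabla_{NC}v)\,dx-\langle s,v\rangle_{\partial\mathcal T}$. *)

theory Defs
  imports "HOL-Analysis.Analysis"
begin

text \<open>The dimension \<open>n\<close> is \<open>DIM('a)\<close> for a Euclidean space \<open>'a\<close>.  Elements of Lebesgue and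
  Sobolev spaces on \<open>U\<close> are represented by functions on the whole type, whose values off \<open>U\<close>
  and on null sets play no role.\<close>

subsection \<open>Domain and triangulation\<close>

text \<open>Near each boundary point, \<open>U\<close> is the strict subgraph of a Lipschitz function of the
  coordinates orthogonal to some direction \<open>e\<close>.\<close>

definition lipschitz_domain :: "'a::euclidean_space set \<Rightarrow> bool" where
  "lipschitz_domain U \<longleftrightarrow> open U \<and> connected U \<and> U \<noteq> {} \<and>
     (\<forall>x\<in>frontier U. \<exists>V e L g. open V \<and> x \<in> V \<and> norm e = 1 \<and>
        L-lipschitz_on {z. z \<bullet> e = 0} (g :: 'a \<Rightarrow> real) \<and>
        U \<inter> V = {y\<in>V. y \<bullet> e < g (y - (y \<bullet> e) *\<^sub>R e)})"

definition polyhedral_boundary :: "'a::euclidean_space set \<Rightarrow> bool" where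
  "polyhedral_boundary U \<longleftrightarrow>
     (\<exists>\<P>. finite \<P> \<and> frontier U = \<Union>\<P> \<and> (\<forall>P\<in>\<P>. polytope P \<and> aff_dim P = int DIM('a) - 1))"

definition triangulation_of :: "'a::euclidean_space set set \<Rightarrow> 'a set \<Rightarrow> bool" where
  "triangulation_of \<T> U \<longleftrightarrow>
     triangulation \<T> \<and> (\<forall>T\<in>\<T>. int DIM('a) simplex T) \<and> \<Union>\<T> = closure U"

definition sides_of :: "'a::euclidean_space set \<Rightarrow> 'a set set" where
  "sides_of T = {E. E facet_of T}"

definition sides :: "'a::euclidean_space set set \<Rightarrow> 'a set set" where
  "sides \<T> = (\<Union>T\<in>\<T>. sides_of T)"

text \<open>The barycenter of a simplex is the mean of its vertices.\<close>

definition mid :: "'a::euclidean_space set \<Rightarrow> 'a" where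
  "mid E = (\<Sum>x | x extreme_point_of E. x) /\<^sub>R real (card {x. x extreme_point_of E})"

text \<open>The constant value on the side \<open>E\<close> of the outer unit normal of \<open>T\<close>.\<close>

definition outer_normal :: "'a::euclidean_space set \<Rightarrow> 'a set \<Rightarrow> 'a" where
  "outer_normal T E =
     (THE \<nu>. norm \<nu> = 1 \<and> (\<exists>c. T \<subseteq> {x. \<nu> \<bullet> x \<le> c} \<and> E = T \<inter> {x. \<nu> \<bullet> x = c}))"

definition side_normals :: "'a::euclidean_space set set \<Rightarrow> ('a set \<Rightarrow> 'a) \<Rightarrow> bool" where
  "side_normals \<T> \<nu> \<longleftrightarrow>
     (\<forall>E\<in>sides \<T>. \<exists>T\<in>\<T>. E \<in> sides_of T \<and> \<nu> E = outer_normal T E)"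

text \<open>Surface measure on flat pieces: \<open>flat_measure S\<close> is the \<open>k\<close>-dimensional Lebesgue measure
  on the affine hull of \<open>S\<close>, where \<open>k\<close> is its dimension, i.e. the image of the product Lebesgue
  measure under an isometric parametrisation by orthonormal coordinates.  It does not depend on
  the chosen orthonormal basis and origin.  If \<open>S\<close> is a point, it is the unit point mass.\<close>

definition flat_basis :: "'a::euclidean_space set \<Rightarrow> 'a set" where
  "flat_basis S = (SOME B. pairwise orthogonal B \<and> (\<forall>b\<in>B. norm b = 1) \<and>
                           span B = span {x - y | x y. x \<in> S \<and> y \<in> S})"

definition flat_measure :: "'a::euclidean_space set \<Rightarrow> 'a measure" where
  "flat_measure S = distr (\<Pi>\<^sub>M b\<in>flat_basis S. (lborel :: real measure)) borel
                          (\<lambda>c. (SOME a. a \<in> S) + (\<Sum>b\<in>flat_basis S. c b *\<^sub>R b))"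

subsection \<open>Function spaces\<close>

definition grad :: "('a::euclidean_space \<Rightarrow> real) \<Rightarrow> 'a \<Rightarrow> 'a" where
  "grad f x = (THE D. GDERIV f x :> D)"

definition L2 :: "'a::euclidean_space set \<Rightarrow> ('a \<Rightarrow> 'b::euclidean_space) set" where
  "L2 U = {u. u \<in> borel_measurable (lebesgue_on U) \<and>
              integrable (lebesgue_on U) (\<lambda>x. (norm (u x))\<^sup>2)}"

definition partial_deriv :: "'a::euclidean_space \<Rightarrow> ('a \<Rightarrow> real) \<Rightarrow> 'a \<Rightarrow> real" where
  "partial_deriv i f x = frechet_derivative f (at x) i"

definition smooth :: "('a::euclidean_space \<Rightarrow> real) \<Rightarrow> bool" where
  "smooth f \<longleftrightarrow> (\<forall>is\<in>lists Basis. \<forall>x. foldr partial_deriv is f differentiable (at x))"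

definition test_functions :: "'a::euclidean_space set \<Rightarrow> ('a \<Rightarrow> real) set" where
  "test_functions U = {\<psi>. smooth \<psi> \<and> (\<exists>K. compact K \<and> K \<subseteq> U \<and> (\<forall>x. x \<notin> K \<longrightarrow> \<psi> x = 0))}"

text \<open>\<open>g\<close> is a square integrable weak gradient of \<open>u\<close>, so \<open>u\<close> is in \<open>H\<^sup>1(U)\<close>.  It is unique up to
  null sets, which makes the choice in \<open>weak_grad\<close> harmless.\<close>

definition has_weak_grad ::
  "'a::euclidean_space set \<Rightarrow> ('a \<Rightarrow> real) \<Rightarrow> ('a \<Rightarrow> 'a) \<Rightarrow> bool" where
  "has_weak_grad U u g \<longleftrightarrow> u \<in> L2 U \<and> g \<in> L2 U \<and>
     (\<forall>\<psi>\<in>test_functions U.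
        (LINT x|lebesgue_on U. u x *\<^sub>R grad \<psi> x) = - (LINT x|lebesgue_on U. \<psi> x *\<^sub>R g x))"

definition weak_grad :: "'a::euclidean_space set \<Rightarrow> ('a \<Rightarrow> real) \<Rightarrow> 'a \<Rightarrow> 'a" where
  "weak_grad U u = (SOME g. has_weak_grad U u g)"

text \<open>The closure of the test functions in \<open>H\<^sup>1(U)\<close>.\<close>

definition H10 :: "'a::euclidean_space set \<Rightarrow> ('a \<Rightarrow> real) set" where
  "H10 U = {u. \<exists>g. has_weak_grad U u g \<and>
     (\<exists>\<psi>. (\<forall>k::nat. \<psi> k \<in> test_functions U) \<and>
          (\<lambda>k. LINT x|lebesgue_on U. (\<psi> k x - u x)\<^sup>2) \<longlonglongrightarrow> 0 \<and>
          (\<lambda>k. LINT x|lebesgue_on U. (norm (grad (\<psi> k) x - g x))\<^sup>2) \<longlonglongrightarrow> 0)}"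

text \<open>Piecewise polynomials are multivalued on the skeleton, so only their values in the
  interiors of the simplices are prescribed; \<open>v|\<^sub>T\<close> on a side of \<open>T\<close> is the limit from inside \<open>T\<close>
  (see \<open>side_trace\<close>), and continuity at a point of the skeleton means that the limit exists
  as the point is approached from the simplex interiors.\<close>

definition P1 :: "'a::euclidean_space set set \<Rightarrow> ('a \<Rightarrow> real) set" where
  "P1 \<T> = {v. \<forall>T\<in>\<T>. \<exists>a c. \<forall>x\<in>interior T. v x = a \<bullet> x + c}"

definition S10 :: "'a::euclidean_space set \<Rightarrow> 'a set set \<Rightarrow> ('a \<Rightarrow> real) set" where
  "S10 \<Omega> \<T> = P1 \<T> \<inter> H10 \<Omega>"

text \<open>A function that is constant on each side is represented by its values on the sides.\<close>

definition P0_sides :: "'a::euclidean_space set set \<Rightarrow> ('a set \<Rightarrow> real) set" where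
  "P0_sides \<T> = sides \<T> \<rightarrow>\<^sub>E UNIV"

definition CR10 :: "'a::euclidean_space set \<Rightarrow> 'a set set \<Rightarrow> ('a \<Rightarrow> real) set" where
  "CR10 \<Omega> \<T> = {v \<in> P1 \<T>. \<forall>E\<in>sides \<T>.
     if E \<subseteq> frontier \<Omega> then (v \<longlongrightarrow> 0) (at (mid E) within (\<Union>T\<in>\<T>. interior T))
     else (\<exists>l. (v \<longlongrightarrow> l) (at (mid E) within (\<Union>T\<in>\<T>. interior T)))}"

definition side_trace :: "'a::euclidean_space set \<Rightarrow> ('a \<Rightarrow> real) \<Rightarrow> 'a \<Rightarrow> real" where
  "side_trace T v x = Lim (at x within interior T) v"

subsection \<open>Nonlinearity\<close>

text \<open>\<open>flux\<close> is the map \<open>\<sigma>\<close> and \<open>Dflux\<close> the formula for its derivative.\<close>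

definition flux :: "(real \<Rightarrow> real) \<Rightarrow> 'a::euclidean_space \<Rightarrow> 'a" where
  "flux \<phi> A = \<phi> (norm A) *\<^sub>R A"

definition Dflux :: "(real \<Rightarrow> real) \<Rightarrow> 'a::euclidean_space \<Rightarrow> 'a \<Rightarrow> 'a" where
  "Dflux \<phi> A B =
     (if A = 0 then \<phi> 0 *\<^sub>R B
      else \<phi> (norm A) *\<^sub>R B
           + (deriv \<phi> (norm A) * norm A) *\<^sub>R (((A /\<^sub>R norm A) \<bullet> B) *\<^sub>R (A /\<^sub>R norm A)))"

definition C2_pos :: "(real \<Rightarrow> real) \<Rightarrow> bool" where
  "C2_pos \<phi> \<longleftrightarrow> (\<forall>t>0. \<phi> differentiable (at t)) \<and> (\<forall>t>0. deriv \<phi> differentiable (at t)) \<and>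
     continuous_on {0<..} (deriv (deriv \<phi>))"

subsection \<open>Forms and discrete problems\<close>

text \<open>The forms are applied to arguments \<open>v\<close>, \<open>w\<close> in \<open>P1 \<T>\<close>, for which the piecewise gradient is the
  pointwise gradient \<open>grad\<close> in the simplex interiors, hence almost everywhere.\<close>

definition form_a :: "'a::euclidean_space set \<Rightarrow> ('a \<Rightarrow> real) \<Rightarrow> ('a \<Rightarrow> real) \<Rightarrow> real" where
  "form_a \<Omega> v w = (LINT x|lebesgue_on \<Omega>. v x * w x + grad v x \<bullet> grad w x)"

definition skeleton_pairing ::
  "'a::euclidean_space set set \<Rightarrow> ('a set \<Rightarrow> 'a) \<Rightarrow> ('a set \<Rightarrow> real) \<Rightarrow> ('a \<Rightarrow> real) \<Rightarrow> real" where
  "skeleton_pairing \<T> \<nu> t v =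
     (\<Sum>T\<in>\<T>. \<Sum>E\<in>sides_of T. (outer_normal T E \<bullet> \<nu> E) *
        (LINT x:E|flat_measure E. t E * side_trace T v x))"

definition form_b ::
  "'a::euclidean_space set \<Rightarrow> 'a set set \<Rightarrow> ('a set \<Rightarrow> 'a) \<Rightarrow> (real \<Rightarrow> real) \<Rightarrow> 
   ('a \<Rightarrow> real) \<Rightarrow> ('a set \<Rightarrow> real) \<Rightarrow> ('a \<Rightarrow> real) \<Rightarrow> real" where
  "form_b \<Omega> \<T> \<nu> \<phi> u t v =
     (LINT x|lebesgue_on \<Omega>. flux \<phi> (weak_grad \<Omega> u x) \<bullet> grad v x) - skeleton_pairing \<T> \<nu> t v"

definition form_b' ::
  "'a::euclidean_space set \<Rightarrow> 'a set set \<Rightarrow> ('a set \<Rightarrow> 'a) \<Rightarrow> (real \<Rightarrow> real) \<Rightarrow> 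
   ('a \<Rightarrow> real) \<Rightarrow> ('a set \<Rightarrow> real) \<Rightarrow> ('a \<Rightarrow> real) \<Rightarrow> ('a set \<Rightarrow> real) \<Rightarrow> ('a \<Rightarrow> real) \<Rightarrow> real" where
  "form_b' \<Omega> \<T> \<nu> \<phi> u t w s v =
     (LINT x|lebesgue_on \<Omega>. weak_grad \<Omega> w x \<bullet> Dflux \<phi> (weak_grad \<Omega> u x) (grad v x))
     - skeleton_pairing \<T> \<nu> s v"

definition load :: "'a::euclidean_space set \<Rightarrow> ('a \<Rightarrow> real) \<Rightarrow> ('a \<Rightarrow> real) \<Rightarrow> real" where
  "load \<Omega> f v = (LINT x|lebesgue_on \<Omega>. f x * v x)"

definition solves_mixed ::
  "'a::euclidean_space set \<Rightarrow> 'a set set \<Rightarrow> ('a set \<Rightarrow> 'a) \<Rightarrow> (real \<Rightarrow> real) \<Rightarrow> 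
   ('a \<Rightarrow> real) \<Rightarrow> ('a \<Rightarrow> real) \<Rightarrow> ('a set \<Rightarrow> real) \<Rightarrow> ('a \<Rightarrow> real) \<Rightarrow> bool" where
  "solves_mixed \<Omega> \<T> \<nu> \<phi> f u t v \<longleftrightarrow>
     u \<in> S10 \<Omega> \<T> \<and> t \<in> P0_sides \<T> \<and> v \<in> P1 \<T> \<and>
     (\<forall>\<eta>\<in>P1 \<T>. form_a \<Omega> v \<eta> + form_b \<Omega> \<T> \<nu> \<phi> u t \<eta> = load \<Omega> f \<eta>) \<and>
     (\<forall>w\<in>S10 \<Omega> \<T>. \<forall>s\<in>P0_sides \<T>. form_b' \<Omega> \<T> \<nu> \<phi> u t w s v = 0)"

definition solves_reduced ::
  "'a::euclidean_space set \<Rightarrow> 'a set set \<Rightarrow> (real \<Rightarrow> real) \<Rightarrow> 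
   ('a \<Rightarrow> real) \<Rightarrow> ('a \<Rightarrow> real) \<Rightarrow> ('a \<Rightarrow> real) \<Rightarrow> bool" where
  "solves_reduced \<Omega> \<T> \<phi> f u v \<longleftrightarrow>
     u \<in> S10 \<Omega> \<T> \<and> v \<in> CR10 \<Omega> \<T> \<and>
     (\<forall>w\<in>CR10 \<Omega> \<T>.
        form_a \<Omega> v w + (LINT x|lebesgue_on \<Omega>. flux \<phi> (weak_grad \<Omega> u x) \<bullet> grad w x)
          = (LINT x|lebesgue_on \<Omega>. f x * w x)) \<and>
     (\<forall>w\<in>S10 \<Omega> \<T>.
        (LINT x|lebesgue_on \<Omega>. weak_grad \<Omega> w x \<bullet> Dflux \<phi> (weak_grad \<Omega> u x) (grad v x)) = 0)"

end

theory Submission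
  imports Defs
begin

text \<open>For piecewise affine \<open>v\<close> the midpoint rule turns the skeleton pairing into
  \<open>\<Sum>\<^sub>E t\<^sub>E |E| [v]\<^sub>E\<close>, where \<open>[v]\<^sub>E\<close> is the signed jump at the barycenter of \<open>E\<close> (the trace itself on
  the boundary).  As a Lipschitz domain is the interior of its closure, a side in the boundary
  belongs to one simplex and every other side to two, with opposite normals; hence the
  Crouzeix-Raviart space is the common kernel of the jumps.  The pairing terms therefore enforce
  \<open>v \<in> CR\<close> and drop out for test functions in \<open>CR\<close>, which gives (a).  The jumps have a dual basis
  in \<open>P1\<close>, so a functional on \<open>P1\<close> that annihilates \<open>CR\<close> is the pairing with exactly one \<open>t\<close>;
  applied to the residual of the reduced problem this gives (b).\<close>

subsection \<open>Surface measure on flat pieces\<close>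

text \<open>The surface measure is given only as the image of a product measure under a chart whose
  orthonormal basis and origin are chosen by \<open>SOME\<close>, so integrals over a side are
  awkward in coordinates. The midpoint rule is therefore reduced to symmetry: invariance under
  translations along the side and finiteness on bounded sets already force all barycentric
  coordinates of the side to have the same integral. As they sum to one, that integral is
  \<open>area E\<close> divided by the number of vertices; \<open>area E\<close> itself is never
  computed, it only has to be positive so that it can be divided out. The geometry at a side rests
  on barycentric coordinates as well. If two simplices share a side, the coordinates of their
  vertices off the side vanish on the same hyperplane and are proportional, and the sign of the
  factor decides between overlap and lying on opposite sides. No angles or determinants occur, and
  the case n = 1, where a side is a point, needs no separate treatment.\<close>

lemma flat_basis_props:
  fixes S :: "'a::euclidean_space set"
  shows flat_basis_orthogonal: "pairwise orthogonal (flat_basis S)"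
    and flat_basis_norm: "b \<in> flat_basis S \<Longrightarrow> norm b = 1"
    and span_flat_basis: "span (flat_basis S) = span {x - y | x y. x \<in> S \<and> y \<in> S}"
    and finite_flat_basis: "finite (flat_basis S)"
proof -
  let ?P = "\<lambda>B. pairwise orthogonal B \<and> (\<forall>b\<in>B. norm b = 1) \<and>
                 span B = span {x - y | x y. x \<in> S \<and> y \<in> S}"
  let ?V = "span {x - y | x y. x \<in> S \<and> y \<in> S}"
  obtain B where B: "B \<subseteq> ?V" "pairwise orthogonal B" "\<And>x. x \<in> B \<Longrightarrow> norm x = 1"
      "independent B" "card B = dim ?V" "span B = ?V"
    by (rule orthonormal_basis_subspace[of ?V, OF subspace_span], rule that; blast)
  then have "?P B" by simp
  then have *: "?P (flat_basis S)"
    unfolding flat_basis_def by (rule someI[of ?P])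
  then show "pairwise orthogonal (flat_basis S)" "b \<in> flat_basis S \<Longrightarrow> norm b = 1"
    "span (flat_basis S) = span {x - y | x y. x \<in> S \<and> y \<in> S}"
    by auto
  have "0 \<notin> flat_basis S"
    using * by (metis norm_zero zero_neq_one)
  then show "finite (flat_basis S)"
    using * pairwise_orthogonal_independent independent_imp_finite by blast
qed

text \<open>The parametrisation inside \<open>flat_measure\<close>, named so that the measure can be
  handled as a single push-forward.\<close>

definition flat_chart :: "'a::euclidean_space set \<Rightarrow> ('a \<Rightarrow> real) \<Rightarrow> 'a" where
  "flat_chart S c = (SOME a. a \<in> S) + (\<Sum>b\<in>flat_basis S. c b *\<^sub>R b)"

abbreviation coord_measure :: "'a::euclidean_space set \<Rightarrow> ('a \<Rightarrow> real) measure" where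
  "coord_measure S \<equiv> \<Pi>\<^sub>M b\<in>flat_basis S. (lborel :: real measure)"

lemma flat_measure_eq_distr: "flat_measure S = distr (coord_measure S) borel (flat_chart S)"
  unfolding flat_measure_def flat_chart_def ..

lemma sets_flat_measure [measurable_cong, simp]: "sets (flat_measure S) = sets borel"
  and space_flat_measure [simp]: "space (flat_measure S) = UNIV"
  by (simp_all add: flat_measure_def)

lemma flat_chart_measurable [measurable]: "flat_chart S \<in> borel_measurable (coord_measure S)"
  unfolding flat_chart_def by measurable

lemma measurable_PiM_lborel_translate:
  fixes d :: "'i \<Rightarrow> real"
  shows "(\<lambda>c. \<lambda>i\<in>I. c i + d i) \<in> measurable (\<Pi>\<^sub>M i\<in>I. lborel) (\<Pi>\<^sub>M i\<in>I. (lborel :: real measure))"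
  by measurable

text \<open>A product measure is determined by its values on boxes, where the claim factors into
  translation invariance of \<open>lborel\<close> in each coordinate. The shifted tuple is
  restricted to \<open>I\<close> because points of the product space are extensional.\<close>

lemma PiM_lborel_translate:
  fixes d :: "'i \<Rightarrow> real"
  assumes "finite I"
  shows "distr (\<Pi>\<^sub>M i\<in>I. lborel) (\<Pi>\<^sub>M i\<in>I. lborel) (\<lambda>c. \<lambda>i\<in>I. c i + d i)
           = (\<Pi>\<^sub>M i\<in>I. (lborel :: real measure))"
proof -
  interpret product_sigma_finite "\<lambda>_::'i. lborel :: real measure" ..
  note m = measurable_PiM_lborel_translate[of d I]
  show ?thesis
  proof (rule PiM_eqI[OF assms])
    fix A :: "'i \<Rightarrow> real set"
    assume A: "\<And>i. i \<in> I \<Longrightarrow> A i \<in> sets lborel"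
    have t: "(\<lambda>x. x + d i) -` A i \<in> sets lborel" if "i \<in> I" for i
      using measurable_sets_borel[of "\<lambda>x. x + d i" borel "A i"] A[OF that] by simp
    have "(\<lambda>c. \<lambda>i\<in>I. c i + d i) -` Pi\<^sub>E I A \<inter> space (\<Pi>\<^sub>M i\<in>I. (lborel :: real measure))
            = Pi\<^sub>E I (\<lambda>i. (\<lambda>x. x + d i) -` A i)"
      by (auto simp: space_PiM PiE_iff)
    then have "emeasure (distr (\<Pi>\<^sub>M i\<in>I. lborel) (\<Pi>\<^sub>M i\<in>I. lborel) (\<lambda>c. \<lambda>i\<in>I. c i + d i)) (Pi\<^sub>E I A)
        = (\<Prod>i\<in>I. emeasure lborel ((\<lambda>x. x + d i) -` A i))"
      using A assms t by (subst emeasure_distr[OF m]) (auto intro!: sets_PiM_I_finite emeasure_PiM)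
    also have "\<dots> = (\<Prod>i\<in>I. emeasure lborel (A i))"
    proof (rule prod.cong[OF refl])
      fix i assume "i \<in> I"
      have "emeasure lborel (A i) = emeasure (distr lborel borel ((+) (d i))) (A i)"
        by (simp add: lborel_distr_plus)
      also have "\<dots> = emeasure lborel ((\<lambda>x. x + d i) -` A i)"
        using A[OF \<open>i \<in> I\<close>] by (subst emeasure_distr) (auto simp: vimage_def add.commute)
      finally show "emeasure lborel ((\<lambda>x. x + d i) -` A i) = emeasure lborel (A i)" ..
    qed
    finally show "emeasure (distr (\<Pi>\<^sub>M i\<in>I. lborel) (\<Pi>\<^sub>M i\<in>I. lborel) (\<lambda>c. \<lambda>i\<in>I. c i + d i)) (Pi\<^sub>E I A)
        = (\<Prod>i\<in>I. emeasure lborel (A i))" .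
  qed simp
qed

lemma span_flat_basis_explicit:
  assumes "d \<in> span (flat_basis S)"
  shows "\<exists>c. d = (\<Sum>b\<in>flat_basis S. c b *\<^sub>R b)"
proof -
  have "d \<in> range (\<lambda>c. \<Sum>b\<in>flat_basis S. c b *\<^sub>R b)"
    using assms by (simp only: span_finite[OF finite_flat_basis])
  then show ?thesis by (rule rangeE) (rule exI)
qed

text \<open>Moving a point by \<open>d\<close> shifts its chart coordinates by the coefficients of
  \<open>d\<close>, so the invariance descends from the product measure.\<close>

lemma flat_measure_translate:
  fixes S :: "'a::euclidean_space set"
  assumes "d \<in> span (flat_basis S)"
  shows "distr (flat_measure S) borel (\<lambda>x. x + d) = flat_measure S"
proof -
  obtain c where c: "d = (\<Sum>b\<in>flat_basis S. c b *\<^sub>R b)"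
    using span_flat_basis_explicit[OF assms] by (rule exE)
  let ?sh = "\<lambda>e. \<lambda>b\<in>flat_basis S. e b + c b"
  note m = measurable_PiM_lborel_translate[of c "flat_basis S"]
  have "distr (flat_measure S) borel (\<lambda>x. x + d)
          = distr (coord_measure S) borel (\<lambda>e. flat_chart S e + d)"
    unfolding flat_measure_eq_distr by (subst distr_distr[OF _ flat_chart_measurable]) (simp_all add: comp_def)
  also have "(\<lambda>e. flat_chart S e + d) = flat_chart S \<circ> ?sh"
    by (auto simp: flat_chart_def c sum.distrib scaleR_add_left)
  also have "distr (coord_measure S) borel (flat_chart S \<circ> ?sh)
      = distr (distr (coord_measure S) (coord_measure S) ?sh) borel (flat_chart S)"
    by (rule distr_distr[OF flat_chart_measurable m, symmetric])
  also have "\<dots> = flat_measure S"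
    by (simp add: PiM_lborel_translate finite_flat_basis flat_measure_eq_distr)
  finally show ?thesis .
qed

lemma flat_basis_coordinate:
  assumes "b \<in> flat_basis S"
  shows "(\<Sum>b'\<in>flat_basis S. c b' *\<^sub>R b') \<bullet> b = c b"
proof -
  have "(\<Sum>b'\<in>flat_basis S. c b' *\<^sub>R b') \<bullet> b = (\<Sum>b'\<in>flat_basis S. if b' = b then c b' else 0)"
    unfolding inner_sum_left
  proof (rule sum.cong[OF refl])
    fix b' assume "b' \<in> flat_basis S"
    with assms show "(c b' *\<^sub>R b') \<bullet> b = (if b' = b then c b' else 0)"
      using flat_basis_orthogonal[of S] flat_basis_norm[of b S]
      by (auto simp: pairwise_def orthogonal_def norm_eq_1)
  qed
  then show ?thesis
    using assms by (simp add: finite_flat_basis)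
qed

lemma emeasure_flat_measure:
  assumes "K \<in> sets borel"
  shows "emeasure (flat_measure S) K
           = emeasure (coord_measure S) (flat_chart S -` K \<inter> space (coord_measure S))"
  using assms unfolding flat_measure_eq_distr by (simp add: emeasure_distr)

lemma emeasure_coord_box:
  fixes l u :: "'a::euclidean_space \<Rightarrow> real"
  assumes "\<And>b. b \<in> flat_basis S \<Longrightarrow> l b \<le> u b"
  shows "emeasure (coord_measure S) (Pi\<^sub>E (flat_basis S) (\<lambda>b. {l b..u b}))
           = ennreal (\<Prod>b\<in>flat_basis S. u b - l b)"
proof -
  interpret product_sigma_finite "\<lambda>_::'a. lborel :: real measure" ..
  show ?thesis
    using assms by (simp add: emeasure_PiM finite_flat_basis prod_ennreal)
qed

text \<open>Chart coordinates are inner products with unit vectors, so the preimage of a bounded set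
  lies in a box.\<close>

lemma emeasure_flat_measure_bounded:
  fixes S :: "'a::euclidean_space set"
  assumes "bounded K" "K \<in> sets borel"
  shows "emeasure (flat_measure S) K < \<infinity>"
proof -
  let ?p = "SOME a. a \<in> S"
  obtain e where e: "\<And>x. x \<in> K \<Longrightarrow> dist ?p x \<le> e"
    using assms(1) bounded_any_center[of K ?p] by blast
  \<comment> \<open>The maximum with 1 keeps the box nonempty if \<open>K\<close> is empty, when
    \<open>e\<close> may be negative.\<close>
  define R where "R = max e 1"
  have R: "norm (x - ?p) \<le> R" "R > 0" if "x \<in> K" for x
    using e[OF that] by (auto simp: R_def dist_norm norm_minus_commute)
  have sub: "flat_chart S -` K \<inter> space (coord_measure S) \<subseteq> Pi\<^sub>E (flat_basis S) (\<lambda>b. {-R..R})"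
  proof
    fix c assume c: "c \<in> flat_chart S -` K \<inter> space (coord_measure S)"
    have "\<bar>c b\<bar> \<le> R" if b: "b \<in> flat_basis S" for b
    proof -
      have "c b = (flat_chart S c - ?p) \<bullet> b"
        by (simp add: flat_chart_def flat_basis_coordinate b)
      also have "\<bar>\<dots>\<bar> \<le> norm (flat_chart S c - ?p)"
        using Cauchy_Schwarz_ineq2[of "flat_chart S c - ?p" b] flat_basis_norm[OF b] by simp
      finally show ?thesis
        using R(1)[of "flat_chart S c"] c by auto
    qed
    then show "c \<in> Pi\<^sub>E (flat_basis S) (\<lambda>b. {-R..R})"
      using c by (simp add: space_PiM PiE_iff abs_le_iff minus_le_iff)
  qed
  have "emeasure (flat_measure S) K \<le> emeasure (coord_measure S) (Pi\<^sub>E (flat_basis S) (\<lambda>b. {-R..R}))"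
    unfolding emeasure_flat_measure[OF assms(2)]
    by (rule emeasure_mono[OF sub]) (auto intro!: sets_PiM_I_finite simp: finite_flat_basis)
  also have "\<dots> < \<infinity>"
    by (subst emeasure_coord_box) (auto simp: R_def)
  finally show ?thesis .
qed

lemma affine_hull_add_span_flat_basis:
  assumes "p \<in> S"
  shows "affine hull S = (\<lambda>x. p + x) ` span (flat_basis S)"
proof -
  have "{x - y | x y. x \<in> S \<and> y \<in> S} \<subseteq> span ((\<lambda>x. - p + x) ` S)"
  proof clarify
    fix x y assume "x \<in> S" "y \<in> S"
    then have "(- p + x) - (- p + y) \<in> span ((\<lambda>x. - p + x) ` S)"
      by (intro span_diff span_base) auto
    then show "x - y \<in> span ((\<lambda>x. - p + x) ` S)" by simp
  qed
  moreover have "(\<lambda>x. - p + x) ` S \<subseteq> {x - y | x y. x \<in> S \<and> y \<in> S}"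
    using assms by auto
  ultimately have "span (flat_basis S) = span ((\<lambda>x. - p + x) ` S)"
    unfolding span_flat_basis by (intro subset_antisym span_minimal[OF _ subspace_span] span_mono)
  then show ?thesis
    using affine_hull_span_gen[of p S] assms by (simp add: hull_inc)
qed

text \<open>The chart maps a small coordinate box around a relative interior point into
  \<open>S\<close>. For a single point the basis is empty and the box is the whole coordinate
  space.\<close>

lemma emeasure_flat_measure_pos:
  fixes S :: "'a::euclidean_space set"
  assumes "rel_interior S \<noteq> {}" "S \<in> sets borel"
  shows "emeasure (flat_measure S) S > 0"
proof -
  let ?p = "SOME a. a \<in> S"
  obtain x r where x: "x \<in> S" and r: "r > 0" "ball x r \<inter> affine hull S \<subseteq> S"
    using assms(1) by (auto simp: mem_rel_interior_ball)
  have p: "?p \<in> S" using x by (rule someI)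
  have x': "x \<in> (\<lambda>y. ?p + y) ` span (flat_basis S)"
    using affine_hull_add_span_flat_basis[OF p] x hull_inc by metis
  then obtain e where e: "e \<in> span (flat_basis S)" and xe: "x = ?p + e" by blast
  obtain d where "e = (\<Sum>b\<in>flat_basis S. d b *\<^sub>R b)"
    using span_flat_basis_explicit[OF e] by (rule exE)
  with xe have d: "x = ?p + (\<Sum>b\<in>flat_basis S. d b *\<^sub>R b)"
    by simp
  \<comment> \<open>Summing the coordinate errors gives at most
    \<open>card (flat_basis S) * \<delta>\<close>, which this choice keeps below \<open>r\<close>;
    the added 1 also covers an empty basis.\<close>
  define \<delta> where "\<delta> = r / (real (card (flat_basis S)) + 1)"
  have \<delta>: "\<delta> > 0" "real (card (flat_basis S)) * \<delta> < r"
    using r by (auto simp: \<delta>_def field_simps)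
  have sub: "Pi\<^sub>E (flat_basis S) (\<lambda>b. {d b - \<delta>..d b + \<delta>})
      \<subseteq> flat_chart S -` S \<inter> space (coord_measure S)"
  proof
    fix c assume c: "c \<in> Pi\<^sub>E (flat_basis S) (\<lambda>b. {d b - \<delta>..d b + \<delta>})"
    have "dist x (flat_chart S c) = norm (\<Sum>b\<in>flat_basis S. (d b - c b) *\<^sub>R b)"
      by (subst d) (simp add: flat_chart_def dist_norm scaleR_diff_left sum_subtractf)
    also have "\<dots> \<le> (\<Sum>b\<in>flat_basis S. \<delta>)"
    proof (rule sum_norm_le)
      fix b assume b: "b \<in> flat_basis S"
      with c have "c b \<in> {d b - \<delta>..d b + \<delta>}" by (auto simp: PiE_iff)
      then show "norm ((d b - c b) *\<^sub>R b) \<le> \<delta>"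
        using flat_basis_norm[OF b] by auto
    qed
    also have "\<dots> < r" using \<delta> by simp
    finally have "flat_chart S c \<in> ball x r" by simp
    moreover have "flat_chart S c \<in> affine hull S"
      unfolding affine_hull_add_span_flat_basis[OF p] flat_chart_def
      by (intro imageI span_sum span_scale span_base)
    ultimately show "c \<in> flat_chart S -` S \<inter> space (coord_measure S)"
      using r c by (auto simp: space_PiM PiE_iff)
  qed
  have "0 < emeasure (coord_measure S) (Pi\<^sub>E (flat_basis S) (\<lambda>b. {d b - \<delta>..d b + \<delta>}))"
    using \<delta> by (subst emeasure_coord_box) (auto intro!: prod_pos)
  also have "\<dots> \<le> emeasure (flat_measure S) S"
    unfolding emeasure_flat_measure[OF assms(2)]
    by (rule emeasure_mono[OF sub]) (use assms(2) in measurable)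
  finally show ?thesis .
qed

subsection \<open>Barycentric coordinates and the midpoint rule\<close>

definition affine_functional :: "('a::euclidean_space \<Rightarrow> real) \<Rightarrow> bool" where
  "affine_functional h \<longleftrightarrow> (\<exists>a c. \<forall>x. h x = a \<bullet> x + c)"

lemma affine_functionalI: "affine_functional (\<lambda>x. a \<bullet> x + c)"
  unfolding affine_functional_def by blast

lemma affine_functional_continuous: "affine_functional h \<Longrightarrow> continuous_on S h"
  unfolding affine_functional_def
  by (elim exE) (simp add: continuous_on_cong[of S S h] continuous_intros)

lemma affine_functional_combination:
  assumes "affine_functional h" "sum u C = 1"
  shows "h (\<Sum>w\<in>C. u w *\<^sub>R w) = (\<Sum>w\<in>C. u w * h w)"
proof -
  obtain a c where h: "\<And>x. h x = a \<bullet> x + c"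
    using assms(1) unfolding affine_functional_def by blast
  have "(\<Sum>w\<in>C. u w * h w) = (\<Sum>w\<in>C. u w * (a \<bullet> w)) + (\<Sum>w\<in>C. u w) * c"
    unfolding h by (simp add: distrib_left sum.distrib sum_distrib_right)
  then show ?thesis
    unfolding h by (simp add: assms(2) inner_sum_right)
qed

lemma affine_functional_line:
  assumes "affine_functional h"
  shows "h (x + s *\<^sub>R (w - v)) = h x + s * (h w - h v)"
  using assms unfolding affine_functional_def by (force simp: algebra_simps)

text \<open>The barycentric coordinate of \<open>v\<close>, extended to the whole space. If
  \<open>C\<close> does not affinely span the space there are several such functionals, but they
  agree on \<open>affine hull C\<close>.\<close>

definition bary :: "'a::euclidean_space set \<Rightarrow> 'a \<Rightarrow> 'a \<Rightarrow> real" where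
  "bary C v = (SOME h. affine_functional h \<and> (\<forall>w\<in>C. h w = (if w = v then 1 else 0)))"

text \<open>Translating another vertex \<open>p\<close> to the origin turns affine into linear
  independence, and a linear functional can be prescribed on the remaining vertices. With a single
  vertex there is no such \<open>p\<close>, but the constant 1 serves.\<close>

lemma bary_props:
  fixes C :: "'a::euclidean_space set"
  assumes "\<not> affine_dependent C" "v \<in> C"
  shows affine_functional_bary: "affine_functional (bary C v)"
    and bary_vertex: "w \<in> C \<Longrightarrow> bary C v w = (if w = v then 1 else 0)"
proof -
  let ?P = "\<lambda>h. affine_functional h \<and> (\<forall>w\<in>C. h w = (if w = v then 1 else 0))"
  have "\<exists>h. ?P h"
  proof (cases "C = {v}")
    case True
    then show ?thesis
      using affine_functionalI[of 0 1] by (intro exI[of _ "\<lambda>_. 1"]) simp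
  next
    case False
    then obtain p where p: "p \<in> C" "p \<noteq> v" using assms(2) by blast
    have "independent ((\<lambda>x. - p + x) ` (C - {p}))"
      using assms(1) affine_dependent_iff_dependent2[OF p(1)] by blast
    from linear_independent_extend[OF this, of "\<lambda>x. if x = - p + v then 1 else 0"]
    obtain g :: "'a \<Rightarrow> real" where g: "linear g"
      "\<forall>x\<in>(\<lambda>x. - p + x) ` (C - {p}). g x = (if x = - p + v then 1 else 0)" by blast
    \<comment> \<open>The Riesz vector of \<open>g\<close>, since affine functionals are encoded
      through an inner product.\<close>
    let ?a = "adjoint g 1"
    have a: "?a \<bullet> x = g x" for x
      using adjoint_works[OF g(1), of x 1] by (simp add: inner_commute)
    have *: "?a \<bullet> x + - (?a \<bullet> p) = g (- p + x)" for x
      using a[of "- p + x"] by (simp add: inner_diff_right)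
    have "?P (\<lambda>x. ?a \<bullet> x + - (?a \<bullet> p))"
    proof (intro conjI ballI affine_functionalI)
      fix w assume w: "w \<in> C"
      show "?a \<bullet> w + - (?a \<bullet> p) = (if w = v then 1 else 0)"
      proof (cases "w = p")
        case False
        then show ?thesis unfolding * using g(2) w by auto
      qed (use p in simp)
    qed
    then show ?thesis by blast
  qed
  then have "?P (bary C v)" unfolding bary_def by (rule someI_ex)
  then show "affine_functional (bary C v)" "w \<in> C \<Longrightarrow> bary C v w = (if w = v then 1 else 0)"
    by auto
qed

lemma bary_combination:
  assumes "\<not> affine_dependent C" "v \<in> C" "sum u C = 1"
  shows "bary C v (\<Sum>w\<in>C. u w *\<^sub>R w) = u v"
proof -
  have fin: "finite C" using assms(1) by (rule aff_independent_finite)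
  have "bary C v (\<Sum>w\<in>C. u w *\<^sub>R w) = (\<Sum>w\<in>C. u w * bary C v w)"
    by (rule affine_functional_combination[OF affine_functional_bary[OF assms(1,2)] assms(3)])
  also have "\<dots> = (\<Sum>w\<in>C. if w = v then u w else 0)"
    by (rule sum.cong[OF refl]) (simp add: bary_vertex[OF assms(1,2)])
  finally show ?thesis using fin assms(2) by simp
qed

lemma bary_affine_hull:
  assumes "\<not> affine_dependent C" "x \<in> affine hull C"
  shows sum_bary: "(\<Sum>v\<in>C. bary C v x) = 1"
    and bary_reconstruct: "(\<Sum>v\<in>C. bary C v x *\<^sub>R v) = x"
proof -
  have fin: "finite C" using assms(1) by (rule aff_independent_finite)
  obtain u where u: "sum u C = 1" "(\<Sum>w\<in>C. u w *\<^sub>R w) = x"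
    using assms(2) unfolding affine_hull_finite[OF fin] by blast
  have "bary C v x = u v" if "v \<in> C" for v
    using bary_combination[OF assms(1) that u(1)] u(2) by simp
  then show "(\<Sum>v\<in>C. bary C v x) = 1" "(\<Sum>v\<in>C. bary C v x *\<^sub>R v) = x"
    using u by simp_all
qed

lemma affine_functional_eq_bary:
  assumes "\<not> affine_dependent C" "x \<in> affine hull C" "affine_functional h"
  shows "h x = (\<Sum>v\<in>C. bary C v x * h v)"
  using affine_functional_combination[OF assms(3) sum_bary[OF assms(1,2)]]
  by (simp add: bary_reconstruct[OF assms(1,2)])

lemma convex_hull_iff_bary:
  assumes "\<not> affine_dependent C"
  shows "x \<in> convex hull C \<longleftrightarrow> x \<in> affine hull C \<and> (\<forall>v\<in>C. 0 \<le> bary C v x)"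
proof
  have fin: "finite C" using assms by (rule aff_independent_finite)
  {
    assume x: "x \<in> convex hull C"
    then obtain u where u: "\<forall>x\<in>C. 0 \<le> u x" "sum u C = 1" "(\<Sum>w\<in>C. u w *\<^sub>R w) = x"
      unfolding convex_hull_finite[OF fin] by blast
    then show "x \<in> affine hull C \<and> (\<forall>v\<in>C. 0 \<le> bary C v x)"
      using bary_combination[OF assms _ u(2)] x convex_hull_subset_affine_hull[of C] by auto
  next
    assume "x \<in> affine hull C \<and> (\<forall>v\<in>C. 0 \<le> bary C v x)"
    then show "x \<in> convex hull C"
      unfolding convex_hull_finite[OF fin]
      using sum_bary[OF assms] bary_reconstruct[OF assms]
      by (intro CollectI exI[of _ "\<lambda>v. bary C v x"]) auto
  }
qed

section \<open>Midpoint rule on a simplex of arbitrary dimension\<close>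

definition area :: "'a::euclidean_space set \<Rightarrow> real" where
  "area E = measure (flat_measure E) E"

text \<open>No dimension is fixed: a single vertex is allowed, which is what a side is when n =
  1.\<close>

locale flat_simplex =
  fixes C :: "'a::euclidean_space set"
  assumes independent: "\<not> affine_dependent C" and nonempty: "C \<noteq> {}"
begin

abbreviation "E \<equiv> convex hull C"
abbreviation "\<mu> \<equiv> restrict_space (flat_measure E) E"

lemma finite: "finite C" using independent by (rule aff_independent_finite)

lemma compact_E: "compact E"
  using finite by (rule finite_imp_compact_convex_hull)

lemma E_borel [measurable]: "E \<in> sets borel"
  using compact_E by (intro borel_closed compact_imp_closed)

lemma E_sets: "E \<inter> space (flat_measure E) \<in> sets (flat_measure E)"
  by simp

lemma space_\<mu> [simp]: "space \<mu> = E"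
  by (simp add: space_restrict_space)

lemma finite_\<mu>: "finite_measure \<mu>"
proof (rule finite_measureI)
  have "emeasure \<mu> (space \<mu>) = emeasure (flat_measure E) E"
    by (simp add: emeasure_restrict_space E_sets)
  also have "\<dots> < \<infinity>"
    using compact_E by (intro emeasure_flat_measure_bounded compact_imp_bounded) auto
  finally show "emeasure \<mu> (space \<mu>) \<noteq> \<infinity>" by simp
qed

lemma measure_\<mu>: "measure \<mu> E = area E"
  by (simp add: measure_restrict_space E_sets area_def)

lemma area_pos: "area E > 0"
proof -
  have "rel_interior E \<noteq> {}"
    using nonempty by (simp add: rel_interior_eq_empty)
  then have "emeasure (flat_measure E) E > 0"
    by (intro emeasure_flat_measure_pos) auto
  moreover have "emeasure (flat_measure E) E < \<infinity>"
    using compact_E by (intro emeasure_flat_measure_bounded compact_imp_bounded) auto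
  ultimately show ?thesis
    by (simp add: area_def measure_def enn2real_positive_iff)
qed

lemma continuous_measurable_\<mu>:
  "continuous_on UNIV h \<Longrightarrow> (h :: 'a \<Rightarrow> real) \<in> borel_measurable \<mu>"
  by (intro measurable_restrict_space1)
     (simp add: borel_measurable_continuous_onI measurable_cong_sets[OF sets_flat_measure refl])

lemma bary_measurable: "v \<in> C \<Longrightarrow> bary C v \<in> borel_measurable \<mu>"
  using affine_functional_bary[OF independent]
  by (intro continuous_measurable_\<mu> affine_functional_continuous)

text \<open>The level sets \<open>{h\<^sub>v \<ge> s}\<close> and \<open>{h\<^sub>w \<ge> s}\<close> in a simplex are translates of each
  other, so all barycentric coordinates have the same distribution.\<close>

lemma translate_level_set:
  assumes "v \<in> C" "w \<in> C" "0 \<le> s" "x \<in> E" "s \<le> bary C v x"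
  shows "x + s *\<^sub>R (w - v) \<in> E \<and> s \<le> bary C w (x + s *\<^sub>R (w - v))"
proof -
  have x: "x \<in> affine hull C" "\<And>u. u \<in> C \<Longrightarrow> 0 \<le> bary C u x"
    using assms(4) convex_hull_iff_bary[OF independent] by auto
  have "x + s *\<^sub>R (w - v) \<in> affine hull C"
    using mem_affine_3_minus[OF affine_affine_hull x(1)] assms(1,2) by (simp add: hull_inc)
  \<comment> \<open>The shift transfers the amount \<open>s\<close> from the coordinate of
    \<open>v\<close> to that of \<open>w\<close> and changes no other coordinate.\<close>
  moreover have eq: "bary C u (x + s *\<^sub>R (w - v))
       = bary C u x + s * ((if w = u then 1 else 0) - (if v = u then 1 else 0))" if "u \<in> C" for u
    using that assms(1,2) affine_functional_line[OF affine_functional_bary[OF independent that]]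
      bary_vertex[OF independent that] by simp
  moreover have "0 \<le> bary C u (x + s *\<^sub>R (w - v))" if "u \<in> C" for u
    using x(2)[OF that] assms(3,5) unfolding eq[OF that] by auto
  ultimately have "x + s *\<^sub>R (w - v) \<in> E"
    unfolding convex_hull_iff_bary[OF independent] by blast
  moreover have "s \<le> bary C w (x + s *\<^sub>R (w - v))"
    using x(2)[OF assms(2)] assms(3,5) unfolding eq[OF assms(2)] by auto
  ultimately show ?thesis by blast
qed

lemma bary_level_set_borel: "v \<in> C \<Longrightarrow> {x \<in> E. s \<le> bary C v x} \<in> sets borel"
  using bary_measurable[of v] measurable_sets[of "bary C v" \<mu> borel "{s..}"]
  by (auto simp: sets_restrict_space_iff E_sets vimage_def Int_def conj_commute)

text \<open>The translation by \<open>s *\<^sub>R (w - v)\<close> carries one level set onto the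
  other and is parallel to the simplex, so it preserves the measure. For negative \<open>s\<close>
  both sets are the whole simplex.\<close>

lemma emeasure_level_set:
  assumes "v \<in> C" "w \<in> C"
  shows "emeasure (flat_measure E) {x \<in> E. s \<le> bary C v x}
           = emeasure (flat_measure E) {x \<in> E. s \<le> bary C w x}"
proof (cases "0 \<le> s")
  case True
  have "w - v \<in> {x - y | x y. x \<in> E \<and> y \<in> E}"
    using assms hull_inc[of _ C convex] by blast
  then have d: "s *\<^sub>R (w - v) \<in> span (flat_basis E)"
    unfolding span_flat_basis by (intro span_scale span_base)
  have eq: "(\<lambda>x. x + s *\<^sub>R (w - v)) -` {x \<in> E. s \<le> bary C w x} = {x \<in> E. s \<le> bary C v x}"
  proof (intro set_eqI iffI)
    \<comment> \<open>Exchanging the two vertices yields the inverse translation.\<close>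
    fix x assume "x \<in> (\<lambda>x. x + s *\<^sub>R (w - v)) -` {x \<in> E. s \<le> bary C w x}"
    then show "x \<in> {x \<in> E. s \<le> bary C v x}"
      using translate_level_set[OF assms(2,1) True, of "x + s *\<^sub>R (w - v)"]
      by (simp add: algebra_simps)
  next
    fix x assume "x \<in> {x \<in> E. s \<le> bary C v x}"
    then show "x \<in> (\<lambda>x. x + s *\<^sub>R (w - v)) -` {x \<in> E. s \<le> bary C w x}"
      using translate_level_set[OF assms True, of x] by simp
  qed
  have "emeasure (flat_measure E) {x \<in> E. s \<le> bary C w x}
      = emeasure (distr (flat_measure E) borel (\<lambda>x. x + s *\<^sub>R (w - v))) {x \<in> E. s \<le> bary C w x}"
    by (simp add: flat_measure_translate[OF d])
  also have "\<dots> = emeasure (flat_measure E) {x \<in> E. s \<le> bary C v x}"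
    using bary_level_set_borel[OF assms(2)] by (subst emeasure_distr) (simp_all only: eq space_flat_measure Int_UNIV_right, measurable)
  finally show ?thesis ..
next
  case False
  have "{x \<in> E. s \<le> bary C u x} = E" if "u \<in> C" for u
  proof -
    have "s \<le> bary C u x" if "x \<in> E" for x
      using that convex_hull_iff_bary[OF independent, of x] \<open>u \<in> C\<close> False by force
    then show ?thesis by blast
  qed
  with assms show ?thesis by simp
qed

text \<open>Closed upper half-lines are stable under intersection and generate the Borel sets, so
  the measures of the level sets determine the distribution; finiteness is needed on the exhausting
  half-lines.\<close>

lemma distr_bary_eq:
  assumes "v \<in> C" "w \<in> C"
  shows "distr \<mu> borel (bary C v) = distr \<mu> borel (bary C w)"
proof (rule measure_eqI_generator_eq)
  have em: "emeasure (distr \<mu> borel (bary C u)) {s..}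
      = emeasure (flat_measure E) {x \<in> E. s \<le> bary C u x}" if "u \<in> C" for u s
  proof -
    have "emeasure (distr \<mu> borel (bary C u)) {s..} = emeasure \<mu> (bary C u -` {s..} \<inter> E)"
      using bary_measurable[OF that] by (simp add: emeasure_distr)
    also have "bary C u -` {s..} \<inter> E = {x \<in> E. s \<le> bary C u x}" by auto
    finally show ?thesis by (simp add: emeasure_restrict_space[OF E_sets])
  qed
  show "Int_stable (range (\<lambda>x::real. {x..}))"
  proof (rule Int_stableI_image)
    fix a b :: real
    show "\<exists>c\<in>UNIV. {a..} \<inter> {b..} = {c..}"
      by (rule bexI[of _ "max a b"]) auto
  qed
  show "range (\<lambda>x::real. {x..}) \<subseteq> Pow UNIV" by simp
  show "emeasure (distr \<mu> borel (bary C v)) X = emeasure (distr \<mu> borel (bary C w)) X"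
    if "X \<in> range (\<lambda>x::real. {x..})" for X
    using that emeasure_level_set[OF assms] em[OF assms(1)] em[OF assms(2)] by auto
  show "sets (distr \<mu> borel (bary C u)) = sigma_sets UNIV (range (\<lambda>x::real. {x..}))" for u
    by (simp add: borel_Ici)
  then show "sets (distr \<mu> borel (bary C w)) = sigma_sets UNIV (range (\<lambda>x::real. {x..}))" .
  show "range (\<lambda>n::nat. {- real n..}) \<subseteq> range (\<lambda>x::real. {x..})" by auto
  show "(\<Union>n::nat. {- real n..}) = UNIV"
  proof -
    have "\<exists>n::nat. - real n \<le> x" for x
      using real_arch_simple[of "- x"] by (auto simp: minus_le_iff)
    then show ?thesis by auto
  qed
  interpret finite_measure "distr \<mu> borel (bary C v)"
    using finite_\<mu> bary_measurable[OF assms(1)] by (rule finite_measure.finite_measure_distr)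
  show "emeasure (distr \<mu> borel (bary C v)) {- real n..} \<noteq> \<infinity>" for n
    by simp
qed

lemma integrable_bary: "v \<in> C \<Longrightarrow> integrable \<mu> (bary C v)"
proof -
  assume v: "v \<in> C"
  have "\<bar>bary C v x\<bar> \<le> 1" if "x \<in> E" for x
  proof -
    have x: "x \<in> affine hull C" "\<And>u. u \<in> C \<Longrightarrow> 0 \<le> bary C u x"
      using that convex_hull_iff_bary[OF independent] by auto
    have "bary C v x \<le> (\<Sum>u\<in>C. bary C u x)"
      using finite v x by (intro member_le_sum) auto
    with x v show ?thesis by (simp add: sum_bary[OF independent])
  qed
  then show ?thesis
    using bary_measurable[OF v]
    by (intro finite_measure.integrable_const_bound[OF finite_\<mu>, of _ 1] AE_I2) auto
qed

text \<open>The integrals for all vertices coincide by equidistribution, and they add up to the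
  integral of 1.\<close>

lemma integral_bary:
  assumes "v \<in> C"
  shows "(LINT x|\<mu>. bary C v x) = area E / card C"
proof -
  have "(LINT x|\<mu>. bary C w x) = (LINT x|\<mu>. bary C v x)" if "w \<in> C" for w
  proof -
    have "(LINT x|\<mu>. bary C u x) = (LINT y|distr \<mu> borel (bary C u). y)" if "u \<in> C" for u
      using bary_measurable[OF that] by (simp add: integral_distr)
    then show ?thesis using distr_bary_eq[OF assms that] that assms by simp
  qed
  then have "real (card C) * (LINT x|\<mu>. bary C v x) = (\<Sum>w\<in>C. LINT x|\<mu>. bary C w x)"
    by simp
  also have "\<dots> = (LINT x|\<mu>. (\<Sum>w\<in>C. bary C w x))"
    using integrable_bary by simp
  also have "\<dots> = (LINT x|\<mu>. 1)"
    using convex_hull_subset_affine_hull[of C]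
    by (intro Bochner_Integration.integral_cong) (auto intro!: sum_bary[OF independent])
  also have "\<dots> = area E" by (simp add: measure_\<mu>)
  finally show ?thesis
    using finite nonempty by (simp add: field_simps)
qed

lemma mid_eq: "mid E = (\<Sum>v\<in>C. (1 / card C) *\<^sub>R v)"
  unfolding mid_def extreme_point_of_convex_hull_affine_independent[OF independent]
  by (simp add: scaleR_right.sum divide_inverse)

lemma sum_weights: "(\<Sum>v\<in>C. 1 / card C) = (1::real)"
  using finite nonempty by simp

lemma mid_in_rel_interior: "mid E \<in> rel_interior E"
  unfolding rel_interior_convex_hull_explicit[OF independent] mid_eq
  using finite nonempty sum_weights
  by (intro CollectI exI[of _ "\<lambda>_. 1 / card C"]) (auto simp: card_gt_0_iff)

text \<open>Expanding \<open>h\<close> in barycentric coordinates gives every vertex value the same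
  weight, and the mean of the vertex values is the value at the barycenter.\<close>

lemma integral_affine:
  assumes "affine_functional h"
  shows "(LINT x:E|flat_measure E. h x) = area E * h (mid E)"
proof -
  have "(LINT x:E|flat_measure E. h x) = (LINT x|\<mu>. h x)"
    by (simp add: set_lebesgue_integral_def integral_restrict_space E_sets)
  also have "\<dots> = (LINT x|\<mu>. (\<Sum>v\<in>C. bary C v x * h v))"
    using convex_hull_subset_affine_hull[of C]
    by (intro Bochner_Integration.integral_cong)
       (auto intro!: affine_functional_eq_bary[OF independent _ assms])
  also have "\<dots> = (\<Sum>v\<in>C. (area E / card C) * h v)"
    using integrable_bary by (simp add: integral_bary)
  also have "\<dots> = area E * (\<Sum>v\<in>C. (1 / card C) * h v)"
    by (simp add: sum_distrib_left)
  also have "(\<Sum>v\<in>C. (1 / card C) * h v) = h (mid E)"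
    unfolding mid_eq by (rule affine_functional_combination[OF assms sum_weights, symmetric])
  finally show ?thesis .
qed

end

subsection \<open>Simplices sharing a side\<close>

definition vertices :: "'a::euclidean_space set \<Rightarrow> 'a set" where
  "vertices T = {x. x extreme_point_of T}"

lemma vertices_convex_hull: "\<not> affine_dependent C \<Longrightarrow> vertices (convex hull C) = C"
  by (simp add: vertices_def extreme_point_of_convex_hull_affine_independent)

locale solid_simplex =
  fixes T :: "'a::euclidean_space set"
  assumes simplex: "int DIM('a) simplex T"
begin

lemma vertices_props:
  shows vertices_independent: "\<not> affine_dependent (vertices T)"
    and card_vertices: "card (vertices T) = DIM('a) + 1"
    and convex_hull_vertices: "convex hull (vertices T) = T"
proof -
  obtain C where "\<not> affine_dependent C" "int (card C) = int DIM('a) + 1" "T = convex hull C"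
    using simplex unfolding simplex_def by blast
  then show "\<not> affine_dependent (vertices T)" "card (vertices T) = DIM('a) + 1"
      "convex hull (vertices T) = T"
    by (simp_all add: vertices_convex_hull)
qed

lemma finite_vertices: "finite (vertices T)"
  using vertices_independent by (rule aff_independent_finite)

lemma convex_T: "convex T" and closed_T: "closed T"
  using convex_simplex[OF simplex] closed_simplex[OF simplex] .

lemma aff_dim_T: "aff_dim T = int DIM('a)"
  using simplex by (rule aff_dim_simplex)

text \<open>Because of this, barycentric coordinates of a full-dimensional simplex decide membership
  for every point of the space.\<close>

lemma affine_hull_vertices: "affine hull (vertices T) = UNIV"
proof -
  have "affine hull (vertices T) = affine hull T"
    using affine_hull_convex_hull[of "vertices T"] unfolding convex_hull_vertices by (rule sym)
  then show ?thesis
    using aff_dim_T by (simp add: aff_dim_eq_full)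
qed

lemma interior_nonempty: "interior T \<noteq> {}"
proof -
  have "T \<noteq> {}"
    using aff_dim_T by auto
  then show ?thesis
    using rel_interior_eq_empty[OF convex_T] interior_rel_interior[OF aff_dim_T] by simp
qed

text \<open>Members of \<open>P1\<close> are prescribed only in simplex interiors; this density
  makes their limits at the points of a side well defined.\<close>

lemma closure_interior_T: "closure (interior T) = T"
  using convex_closure_interior[OF convex_T interior_nonempty] closed_T by simp

abbreviation bar :: "'a \<Rightarrow> 'a \<Rightarrow> real" where
  "bar \<equiv> bary (vertices T)"

lemmas affine_functional_bar = affine_functional_bary[OF vertices_independent]
lemmas bar_vertex = bary_vertex[OF vertices_independent]

lemma mem_iff_bar: "x \<in> T \<longleftrightarrow> (\<forall>v\<in>vertices T. 0 \<le> bar v x)"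
  using convex_hull_iff_bary[OF vertices_independent, of x]
  by (simp add: affine_hull_vertices convex_hull_vertices)

text \<open>Used with all vertices, to find interior points, and with all but one, to get a
  neighbourhood of the barycenter of a side.\<close>

lemma open_bar_pos: "open {x. \<forall>v\<in>V. 0 < bar v x}" if "V \<subseteq> vertices T"
proof -
  have "open {x. 0 < bar v x}" if "v \<in> vertices T" for v
    using affine_functional_continuous[OF affine_functional_bar[OF that]]
    by (intro open_Collect_less continuous_on_const)
  moreover have "{x. \<forall>v\<in>V. 0 < bar v x} = (\<Inter>v\<in>V. {x. 0 < bar v x})" by auto
  ultimately show ?thesis
    using \<open>V \<subseteq> vertices T\<close> finite_subset[OF _ finite_vertices] by (auto intro!: open_INT)
qed

lemma mem_interior_if_bar_pos:
  assumes "\<And>v. v \<in> vertices T \<Longrightarrow> 0 < bar v x"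
  shows "x \<in> interior T"
proof (rule interiorI[OF open_bar_pos[OF subset_refl]])
  show "{x. \<forall>v\<in>vertices T. 0 < bar v x} \<subseteq> T"
    by (auto simp: mem_iff_bar less_imp_le)
qed (use assms in auto)

definition opposite :: "'a \<Rightarrow> 'a set" where
  "opposite z = convex hull (vertices T - {z})"

lemma facet_iff: "E facet_of T \<longleftrightarrow> (\<exists>z\<in>vertices T. E = opposite z)"
  using facet_of_convex_hull_affine_independent_alt[OF vertices_independent, of E]
  unfolding convex_hull_vertices card_vertices opposite_def[symmetric]
  by (simp add: Bex_def Suc_le_eq)

lemma facet_side: "z \<in> vertices T \<Longrightarrow> flat_simplex (vertices T - {z})"
proof
  assume z: "z \<in> vertices T"
  show "\<not> affine_dependent (vertices T - {z})"
    using affine_independent_subset[OF vertices_independent] by blast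
  have "card (vertices T - {z}) = DIM('a)"
    using z card_vertices finite_vertices by (simp add: card_Diff_singleton)
  then show "vertices T - {z} \<noteq> {}"
    using DIM_positive[where 'a = 'a] by (metis card.empty less_irrefl)
qed

lemma opposite_inject:
  assumes "z \<in> vertices T" "y \<in> vertices T" "opposite z = opposite y"
  shows "z = y"
proof -
  have "vertices T - {x} = vertices (opposite x)" if "x \<in> vertices T" for x
    using vertices_convex_hull[OF flat_simplex.independent[OF facet_side[OF that]]]
    unfolding opposite_def by (rule sym)
  then have "vertices T - {z} = vertices T - {y}" using assms by metis
  then show ?thesis using assms(1) by blast
qed

text \<open>The barycenter puts weight 1/n on each of the n vertices of the side and weight 0 on
  \<open>z\<close>. This is the origin of the factor n in the dual basis of the jumps.\<close>

lemma bar_mid_opposite: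
  assumes "z \<in> vertices T" "v \<in> vertices T"
  shows "bar v (mid (opposite z)) = (if v = z then 0 else 1 / DIM('a))"
proof -
  have c: "card (vertices T - {z}) = DIM('a)"
    using assms(1) card_vertices finite_vertices by (simp add: card_Diff_singleton)
  let ?u = "\<lambda>w. if w = z then 0 else 1 / real DIM('a)"
  have "mid (opposite z) = (\<Sum>w\<in>vertices T - {z}. (1 / DIM('a)) *\<^sub>R w)"
    unfolding opposite_def flat_simplex.mid_eq[OF facet_side[OF assms(1)]] c ..
  also have "\<dots> = (\<Sum>w\<in>vertices T. ?u w *\<^sub>R w)"
    using assms(1) finite_vertices by (simp add: sum.remove[of _ z])
  finally have m: "mid (opposite z) = (\<Sum>w\<in>vertices T. ?u w *\<^sub>R w)" .
  have "sum ?u (vertices T) = 1"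
    using assms(1) finite_vertices c by (simp add: sum.remove[of _ z])
  then show ?thesis
    unfolding m using bary_combination[OF vertices_independent assms(2)] by simp
qed

text \<open>Where the coordinate of \<open>z\<close> vanishes, the remaining ones still sum to 1 and
  exhibit the point as a convex combination of the vertices of the facet.\<close>

lemma opposite_eq:
  assumes "z \<in> vertices T"
  shows "opposite z = T \<inter> {x. bar z x = 0}"
proof (intro set_eqI iffI)
  fix x assume x: "x \<in> opposite z"
  interpret F: flat_simplex "vertices T - {z}" using assms by (rule facet_side)
  have "opposite z \<subseteq> convex hull (vertices T)"
    unfolding opposite_def by (intro hull_mono) blast
  then have "x \<in> T"
    using x convex_hull_vertices by blast
  have "x \<in> affine hull (vertices T - {z})"
    using x convex_hull_subset_affine_hull unfolding opposite_def by blast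
  then have "bar z x = (\<Sum>v\<in>vertices T - {z}. bary (vertices T - {z}) v x * bar z v)"
    by (rule affine_functional_eq_bary[OF F.independent _ affine_functional_bar[OF assms]])
  also have "\<dots> = 0"
    by (rule sum.neutral) (simp add: bar_vertex[OF assms])
  finally show "x \<in> T \<inter> {x. bar z x = 0}" using \<open>x \<in> T\<close> by simp
next
  fix x assume x: "x \<in> T \<inter> {x. bar z x = 0}"
  have "(\<Sum>v\<in>vertices T. bar v x) = 1" "(\<Sum>v\<in>vertices T. bar v x *\<^sub>R v) = x"
    using bary_affine_hull[OF vertices_independent, of x] affine_hull_vertices by simp_all
  then have s: "(\<Sum>v\<in>vertices T - {z}. bar v x) = 1" "(\<Sum>v\<in>vertices T - {z}. bar v x *\<^sub>R v) = x"
    using x sum.remove[OF finite_vertices assms, of "\<lambda>v. bar v x"]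
      sum.remove[OF finite_vertices assms, of "\<lambda>v. bar v x *\<^sub>R v"] by simp_all
  have "\<forall>v\<in>vertices T - {z}. 0 \<le> bar v x"
    using x mem_iff_bar by blast
  then show "x \<in> opposite z"
    using s finite_vertices unfolding opposite_def
    by (subst convex_hull_finite) (auto intro: exI[of _ "\<lambda>v. bar v x"])
qed

text \<open>Only the term of \<open>z\<close> survives in the barycentric expansion. This gives both
  the uniqueness of the outer normal and the proportionality of coordinates across a shared
  side.\<close>

lemma affine_functional_vanishing_on_opposite:
  assumes "z \<in> vertices T" "affine_functional g" "\<And>w. w \<in> vertices T - {z} \<Longrightarrow> g w = 0"
  shows "g x = g z * bar z x"
proof -
  have "g x = (\<Sum>v\<in>vertices T. bar v x * g v)"
    by (rule affine_functional_eq_bary[OF vertices_independent _ assms(2)])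
      (simp add: affine_hull_vertices)
  also have "\<dots> = bar z x * g z + (\<Sum>v\<in>vertices T - {z}. bar v x * g v)"
    by (rule sum.remove[OF finite_vertices assms(1)])
  also have "(\<Sum>v\<in>vertices T - {z}. bar v x * g v) = 0"
    using assms(3) by (intro sum.neutral) simp
  finally show ?thesis by simp
qed

lemma bar_gradient_nonzero:
  assumes "z \<in> vertices T" "\<And>x. bar z x = a \<bullet> x + c"
  shows "a \<noteq> 0"
proof
  assume a: "a = 0"
  obtain w where "w \<in> vertices T" "w \<noteq> z"
    using flat_simplex.nonempty[OF facet_side[OF assms(1)]] by blast
  with assms a bar_vertex[OF assms(1), of w] bar_vertex[OF assms(1), of z] show False by simp
qed

text \<open>An outer normal functional vanishes on all vertices but \<open>z\<close> and is therefore a multiple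
  of the barycentric coordinate of \<open>z\<close>.\<close>

lemma outer_normal_opposite:
  assumes z: "z \<in> vertices T" and a: "\<And>x. bar z x = a \<bullet> x + c"
  shows "outer_normal T (opposite z) = - a /\<^sub>R norm a"
  unfolding outer_normal_def
proof (rule the_equality)
  have na: "norm a > 0" using bar_gradient_nonzero[OF z a] by simp
  have n: "(- a /\<^sub>R norm a) \<bullet> x = (c - bar z x) / norm a" for x
    by (simp add: a divide_inverse)
  \<comment> \<open>Nonnegativity of the coordinate of \<open>z\<close> on \<open>T\<close> becomes
    the supporting half-space condition, with equality exactly where that coordinate is 0.\<close>
  have "T \<subseteq> {x. (- a /\<^sub>R norm a) \<bullet> x \<le> c / norm a}"
  proof
    fix x assume "x \<in> T"
    then have "0 \<le> bar z x" using z mem_iff_bar by blast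
    with na show "x \<in> {x. (- a /\<^sub>R norm a) \<bullet> x \<le> c / norm a}"
      unfolding mem_Collect_eq n by (simp add: divide_right_mono)
  qed
  moreover have "opposite z = T \<inter> {x. (- a /\<^sub>R norm a) \<bullet> x = c / norm a}"
    unfolding opposite_eq[OF z] n using na by (auto simp: divide_simps)
  ultimately show "norm (- a /\<^sub>R norm a) = 1 \<and> (\<exists>c. T \<subseteq> {x. (- a /\<^sub>R norm a) \<bullet> x \<le> c} \<and>
      opposite z = T \<inter> {x. (- a /\<^sub>R norm a) \<bullet> x = c})"
    using na by auto
next
  fix \<mu> assume \<mu>: "norm \<mu> = 1 \<and> (\<exists>c. T \<subseteq> {x. \<mu> \<bullet> x \<le> c} \<and> opposite z = T \<inter> {x. \<mu> \<bullet> x = c})"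
  then obtain d where d: "T \<subseteq> {x. \<mu> \<bullet> x \<le> d}" "opposite z = T \<inter> {x. \<mu> \<bullet> x = d}" by blast
  have na: "norm a > 0" using bar_gradient_nonzero[OF z a] by simp
  have vT: "vertices T \<subseteq> T"
    using hull_subset[of "vertices T" convex] convex_hull_vertices by simp
  let ?g = "\<lambda>x. (- \<mu>) \<bullet> x + d"
  have g0: "?g w = 0" if "w \<in> vertices T - {z}" for w
  proof -
    have "w \<in> opposite z" unfolding opposite_def using that by (rule hull_inc)
    then show ?thesis using d(2) by simp
  qed
  have eq: "?g x = ?g z * bar z x" for x
    by (rule affine_functional_vanishing_on_opposite[OF z affine_functionalI g0])
  have "z \<notin> opposite z"
    unfolding opposite_eq[OF z] using bar_vertex[OF z z] by simp
  then have gz: "?g z > 0" using d z vT by force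
  \<comment> \<open>Comparing the values at \<open>x\<close> and at 0 removes the constants; the
    unit norm then fixes the factor.\<close>
  have "(- \<mu>) \<bullet> x = (?g z *\<^sub>R a) \<bullet> x" for x
    using eq[of x] eq[of 0] by (simp add: a algebra_simps)
  then have m: "\<mu> = - ?g z *\<^sub>R a"
    by (metis vector_eq_rdot minus_minus scaleR_minus_left)
  have "norm \<mu> = ?g z * norm a"
    using arg_cong[OF m, of norm] gz by simp
  then have "?g z = inverse (norm a)" using \<mu> na by (simp add: field_simps)
  then have "- ?g z *\<^sub>R a = - a /\<^sub>R norm a" by simp
  with m show "\<mu> = - a /\<^sub>R norm a" by (rule trans)
qed

lemma norm_outer_normal:
  assumes "E facet_of T"
  shows "norm (outer_normal T E) = 1"
proof -
  obtain z where z: "z \<in> vertices T" "E = opposite z" using assms facet_iff by blast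
  obtain a c where a: "\<And>x. bar z x = a \<bullet> x + c"
    using affine_functional_bar[OF z(1)] unfolding affine_functional_def by blast
  show ?thesis
    using bar_gradient_nonzero[OF z(1) a] by (simp add: outer_normal_opposite[OF z(1) a] z(2))
qed

text \<open>The other coordinates equal 1/n at the barycenter and stay positive nearby, so there the
  sign of the coordinate of \<open>z\<close> alone decides membership in \<open>T\<close>.\<close>

lemma near_mid_opposite:
  assumes "z \<in> vertices T"
  shows "\<forall>\<^sub>F x in nhds (mid (opposite z)). \<forall>w\<in>vertices T - {z}. 0 < bar w x"
proof -
  have "open {x. \<forall>w\<in>vertices T - {z}. 0 < bar w x}" by (rule open_bar_pos) blast
  moreover have "mid (opposite z) \<in> {x. \<forall>w\<in>vertices T - {z}. 0 < bar w x}"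
    using assms by (simp add: bar_mid_opposite)
  ultimately show ?thesis
    unfolding eventually_nhds by (intro exI conjI) auto
qed

lemma facet_convex_hull:
  assumes "E facet_of T"
  shows "flat_simplex (vertices E) \<and> E = convex hull (vertices E)"
proof -
  obtain z where z: "z \<in> vertices T" "E = opposite z" using assms facet_iff by blast
  interpret F: flat_simplex "vertices T - {z}" using z(1) by (rule facet_side)
  have "vertices E = vertices T - {z}"
    unfolding z(2) opposite_def by (rule vertices_convex_hull[OF F.independent])
  then show ?thesis using F.flat_simplex_axioms z(2) by (simp add: opposite_def)
qed

end

text \<open>The coordinates of the two vertices off \<open>E\<close> both vanish on
  \<open>E\<close>, hence are proportional with factor \<open>?k\<close>. A positive factor would
  produce common interior points near \<open>mid E\<close>. With a negative one the gradients are
  opposite, and the two simplices fill both half-spaces near \<open>mid E\<close>.\<close>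

lemma simplices_sharing_facet:
  fixes T T' :: "'a::euclidean_space set"
  assumes "int DIM('a) simplex T" "int DIM('a) simplex T'" "E facet_of T" "E facet_of T'"
    and disj: "interior T \<inter> interior T' = {}"
  shows "outer_normal T' E = - outer_normal T E" "mid E \<in> interior (T \<union> T')"
proof -
  interpret T: solid_simplex T by standard fact
  interpret T': solid_simplex T' by standard fact
  obtain z where z: "z \<in> vertices T" "E = T.opposite z" using assms(3) T.facet_iff by blast
  obtain z' where z': "z' \<in> vertices T'" "E = T'.opposite z'" using assms(4) T'.facet_iff by blast
  have VE: "vertices T - {z} = vertices T' - {z'}"
    using vertices_convex_hull[OF flat_simplex.independent[OF T.facet_side[OF z(1)]]]
      vertices_convex_hull[OF flat_simplex.independent[OF T'.facet_side[OF z'(1)]]] z(2) z'(2)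
    unfolding T.opposite_def T'.opposite_def by simp
  let ?k = "T'.bar z' z"
  have bar': "T'.bar z' x = ?k * T.bar z x" for x
  proof (rule T.affine_functional_vanishing_on_opposite[OF z(1) T'.affine_functional_bar[OF z'(1)]])
    fix w assume "w \<in> vertices T - {z}"
    then have "w \<in> vertices T'" "w \<noteq> z'" using VE by auto
    then show "T'.bar z' w = 0" using T'.bar_vertex[OF z'(1)] by simp
  qed
  obtain a c where a: "\<And>x. T.bar z x = a \<bullet> x + c"
    using T.affine_functional_bar[OF z(1)] unfolding affine_functional_def by blast
  have a': "T'.bar z' x = (?k *\<^sub>R a) \<bullet> x + ?k * c" for x
    unfolding bar'[of x] a by (simp add: algebra_simps)
  have near: "\<forall>\<^sub>F x in nhds (mid E). (\<forall>w\<in>vertices T - {z}. 0 < T.bar w x) \<and>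
      (\<forall>w\<in>vertices T' - {z'}. 0 < T'.bar w x)"
    using T.near_mid_opposite[OF z(1)] T'.near_mid_opposite[OF z'(1)] z(2) z'(2)
    by (simp add: eventually_conj)
  have "?k \<le> 0"
  proof (rule ccontr)
    assume k: "\<not> ?k \<le> 0"
    \<comment> \<open>Moving from the barycenter towards \<open>z\<close> makes the coordinate of
      \<open>z\<close> equal to \<open>t\<close>, while the other coordinates stay positive for
      small \<open>t\<close>.\<close>
    let ?x = "\<lambda>t. mid E + t *\<^sub>R (z - mid E)"
    have "(?x \<longlongrightarrow> mid E + 0 *\<^sub>R (z - mid E)) (at_right 0)"
      by (intro tendsto_intros)
    then have "filterlim ?x (nhds (mid E)) (at_right 0)" by simp
    then have "\<forall>\<^sub>F t in at_right 0. (\<forall>w\<in>vertices T - {z}. 0 < T.bar w (?x t)) \<and>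
        (\<forall>w\<in>vertices T' - {z'}. 0 < T'.bar w (?x t))"
      by (rule eventually_compose_filterlim[OF near])
    moreover have "\<forall>\<^sub>F t in at_right (0::real). 0 < t"
      by (rule eventually_at_right_less)
    ultimately have "\<forall>\<^sub>F t in at_right (0::real). 0 < t \<and> (\<forall>w\<in>vertices T - {z}. 0 < T.bar w (?x t)) \<and>
        (\<forall>w\<in>vertices T' - {z'}. 0 < T'.bar w (?x t))"
      by eventually_elim auto
    then obtain t where t: "0 < t" "\<forall>w\<in>vertices T - {z}. 0 < T.bar w (?x t)"
        "\<forall>w\<in>vertices T' - {z'}. 0 < T'.bar w (?x t)"
      using eventually_happens'[OF trivial_limit_at_right_real] by blast
    have "T.bar z (?x t) = t"
      using affine_functional_line[OF T.affine_functional_bar[OF z(1)]] z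
        T.bar_mid_opposite[OF z(1) z(1)] T.bar_vertex[OF z(1) z(1)] by simp
    then have "0 < T.bar z (?x t)" "0 < T'.bar z' (?x t)"
      using t(1) k bar'[of "?x t"] by auto
    then have "?x t \<in> interior T" "?x t \<in> interior T'"
      using t(2,3) by (auto intro!: T.mem_interior_if_bar_pos T'.mem_interior_if_bar_pos)
    with disj show False by blast
  qed
  moreover have "?k \<noteq> 0"
    using bar'[of z'] T'.bar_vertex[OF z'(1) z'(1)] by auto
  ultimately have k: "?k < 0" by simp
  have "outer_normal T' E = - (?k *\<^sub>R a) /\<^sub>R norm (?k *\<^sub>R a)"
    using T'.outer_normal_opposite[OF z'(1) a'] z'(2) by simp
  also have "\<dots> = - outer_normal T E"
    using T.outer_normal_opposite[OF z(1) a] z(2) k by simp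
  finally show "outer_normal T' E = - outer_normal T E" .
  \<comment> \<open>Since \<open>?k\<close> is negative, at every point at least one of the two
    coordinates is nonnegative.\<close>
  have "\<forall>\<^sub>F x in nhds (mid E). x \<in> T \<union> T'"
    using near
  proof eventually_elim
    case (elim x)
    show ?case
    proof (cases "0 \<le> T.bar z x")
      case True
      then have "x \<in> T" using elim unfolding T.mem_iff_bar by (metis Diff_iff less_imp_le singletonD)
      then show ?thesis by simp
    next
      case False
      then have "0 \<le> T'.bar z' x" unfolding bar'[of x] using k by (simp add: mult_nonpos_nonpos)
      then have "x \<in> T'" using elim unfolding T'.mem_iff_bar by (metis Diff_iff less_imp_le singletonD)
      then show ?thesis by simp
    qed
  qed
  then obtain S where "open S" "mid E \<in> S" "\<forall>x\<in>S. x \<in> T \<union> T'"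
    unfolding eventually_nhds by (elim exE conjE)
  then show "mid E \<in> interior (T \<union> T')"
    by (intro interiorI[of S]) auto
qed

subsection \<open>Jumps across sides\<close>

text \<open>A point of the left-hand set outside \<open>U\<close> would be a frontier point on or
  above the local graph. Slightly further up there is a nonempty open set strictly above the graph,
  disjoint from \<open>U\<close> and yet inside its closure. This excludes slits, so a side between
  two simplices cannot lie in the frontier.\<close>

lemma lipschitz_domain_interior_closure:
  fixes U :: "'a::euclidean_space set"
  assumes "lipschitz_domain U"
  shows "interior (closure U) \<subseteq> U"
proof
  fix x assume x: "x \<in> interior (closure U)"
  show "x \<in> U"
  proof (rule ccontr)
    assume "x \<notin> U"
    have "open U" using assms unfolding lipschitz_domain_def by blast
    then have "x \<in> frontier U"
      using x \<open>x \<notin> U\<close> interior_subset[of "closure U"] by (auto simp: frontier_def interior_open)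
    then obtain V e L g where V: "open V" "x \<in> V" and e: "norm e = 1"
      and g: "L-lipschitz_on {z. z \<bullet> e = 0} (g :: 'a \<Rightarrow> real)"
      and U: "U \<inter> V = {y\<in>V. y \<bullet> e < g (y - (y \<bullet> e) *\<^sub>R e)}"
      using assms unfolding lipschitz_domain_def by meson
    have ee: "e \<bullet> e = 1" using e by (simp add: norm_eq_1)
    define h where "h y = y \<bullet> e - g (y - (y \<bullet> e) *\<^sub>R e)" for y
    have "continuous_on UNIV (\<lambda>y. g (y - (y \<bullet> e) *\<^sub>R e))"
      by (rule continuous_on_compose2[OF lipschitz_on_continuous_on[OF g]])
        (auto intro!: continuous_intros simp: inner_diff_left ee)
    then have h_cont: "continuous_on UNIV h"
      unfolding h_def by (intro continuous_intros)
    \<comment> \<open>Moving along \<open>e\<close> leaves the orthogonal coordinates, and hence the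
      graph value, unchanged.\<close>
    have h_line: "h (x + s *\<^sub>R e) = h x + s" for s
      by (simp add: h_def inner_add_left ee algebra_simps)
    have "x \<notin> U \<inter> V" using \<open>x \<notin> U\<close> by blast
    then have hx: "0 \<le> h x" unfolding U h_def using V by simp
    let ?W = "V \<inter> interior (closure U) \<inter> {y. 0 < h y}"
    have "((\<lambda>s. x + s *\<^sub>R e) \<longlongrightarrow> x + 0 *\<^sub>R e) (at_right 0)"
      by (intro tendsto_intros)
    then have lim: "((\<lambda>s. x + s *\<^sub>R e) \<longlongrightarrow> x) (at_right 0)" by simp
    have "open (V \<inter> interior (closure U))" using V(1) by blast
    from topological_tendstoD[OF lim this] have "\<forall>\<^sub>F s in at_right 0. x + s *\<^sub>R e \<in> V \<inter> interior (closure U)"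
      using x V(2) by blast
    moreover have "\<forall>\<^sub>F s in at_right (0::real). 0 < s"
      by (rule eventually_at_right_less)
    ultimately have "\<forall>\<^sub>F s in at_right 0. x + s *\<^sub>R e \<in> ?W"
      by eventually_elim (use hx h_line in auto)
    then obtain s where s: "x + s *\<^sub>R e \<in> ?W"
      using eventually_happens'[OF trivial_limit_at_right_real] by blast
    have "open ?W"
      using V(1) h_cont by (intro open_Int open_interior open_Collect_less continuous_on_const)
    moreover have "?W \<inter> U = {}"
    proof -
      have False if "y \<in> V" "y \<in> U" "0 < h y" for y
      proof -
        have "y \<in> U \<inter> V" using that by blast
        then show False using that(3) unfolding U h_def by simp
      qed
      then show ?thesis by blast
    qed
    ultimately have "?W \<inter> closure U = {}"
      by (simp only: open_Int_closure_eq_empty)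
    moreover have "?W \<subseteq> closure U" using interior_subset[of "closure U"] by blast
    ultimately show False using s by blast
  qed
qed

lemma tendsto_within_UN_finite:
  assumes "finite A"
  shows "(v \<longlongrightarrow> l) (at x within (\<Union>T\<in>A. S T)) \<longleftrightarrow> (\<forall>T\<in>A. (v \<longlongrightarrow> l) (at x within S T))"
  using assms
proof induction
  case (insert T A)
  have "(v \<longlongrightarrow> l) (at x within S T \<union> (\<Union>T\<in>A. S T))
      \<longleftrightarrow> (v \<longlongrightarrow> l) (at x within S T) \<and> (v \<longlongrightarrow> l) (at x within (\<Union>T\<in>A. S T))"
    unfolding at_within_union by (auto intro: filterlim_sup elim: tendsto_mono[rotated])
  with insert show ?case by simp
qed simp

text \<open>On the interior \<open>v\<close> agrees with a continuous function. Nontriviality of the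
  filter makes the limit unique, without which \<open>Lim\<close> would carry no
  information.\<close>

lemma (in solid_simplex) trace_limit:
  assumes "affine_functional h" "\<And>y. y \<in> interior T \<Longrightarrow> v y = h y" "x \<in> T"
  shows tendsto_trace: "(v \<longlongrightarrow> h x) (at x within interior T)"
    and at_within_interior_nontrivial: "at x within interior T \<noteq> bot"
    and side_trace_eq: "side_trace T v x = h x"
proof -
  have "x islimpt closure (interior T)"
    using islimpt_closure_open[OF open_interior, of T "interior T" x] assms(3)
    by (simp add: closure_interior_T islimpt_closure_open[OF open_interior refl])
  then show nt: "at x within interior T \<noteq> bot"
    by (simp add: limpt_of_closure trivial_limit_within)
  have "(h \<longlongrightarrow> h x) (at x within interior T)"
    using affine_functional_continuous[OF assms(1), of UNIV]
    by (simp add: continuous_on_eq_continuous_at continuous_at_imp_continuous_at_within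
        flip: continuous_within)
  then show lim: "(v \<longlongrightarrow> h x) (at x within interior T)"
    by (rule Lim_transform_eventually) (simp add: eventually_at_filter assms(2))
  show "side_trace T v x = h x"
    unfolding side_trace_def using nt lim by (intro tendsto_Lim) auto
qed

lemma P1_affine_functional:
  assumes "v \<in> P1 \<T>" "T \<in> \<T>"
  obtains h where "affine_functional h" "\<And>x. x \<in> interior T \<Longrightarrow> v x = h x"
proof -
  obtain a c where "\<forall>x\<in>interior T. v x = a \<bullet> x + c"
    using assms unfolding P1_def by blast
  then show thesis by (intro that[OF affine_functionalI]) auto
qed

lemma affine_functional_add_mult:
  assumes "affine_functional h" "affine_functional k"
  shows "affine_functional (\<lambda>x. h x + c * k x)"
proof -
  obtain a b a' b' where "\<And>x. h x = a \<bullet> x + b" "\<And>x. k x = a' \<bullet> x + b'"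
    using assms unfolding affine_functional_def by blast
  then have "h x + c * k x = (a + c *\<^sub>R a') \<bullet> x + (b + c * b')" for x
    by (simp add: algebra_simps)
  then show ?thesis unfolding affine_functional_def by blast
qed

lemma P1_iff_affine_functional:
  "v \<in> P1 \<T> \<longleftrightarrow> (\<forall>T\<in>\<T>. \<exists>h. affine_functional h \<and> (\<forall>x\<in>interior T. v x = h x))"
proof
  assume "v \<in> P1 \<T>"
  then show "\<forall>T\<in>\<T>. \<exists>h. affine_functional h \<and> (\<forall>x\<in>interior T. v x = h x)"
    by (metis P1_affine_functional)
next
  assume R: "\<forall>T\<in>\<T>. \<exists>h. affine_functional h \<and> (\<forall>x\<in>interior T. v x = h x)"
  show "v \<in> P1 \<T>"
    unfolding P1_def
  proof (intro CollectI ballI)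
    fix T assume "T \<in> \<T>"
    with R obtain h where "affine_functional h" "\<forall>x\<in>interior T. v x = h x" by blast
    then show "\<exists>a c. \<forall>x\<in>interior T. v x = a \<bullet> x + c"
      unfolding affine_functional_def by auto
  qed
qed

lemma P1_add_mult:
  assumes "v \<in> P1 \<T>" "w \<in> P1 \<T>"
  shows "(\<lambda>x. v x + c * w x) \<in> P1 \<T>"
  unfolding P1_iff_affine_functional
proof
  fix T assume T: "T \<in> \<T>"
  obtain h where h: "affine_functional h" "\<And>x. x \<in> interior T \<Longrightarrow> v x = h x"
    using assms(1) T by (rule P1_affine_functional) blast
  obtain k where k: "affine_functional k" "\<And>x. x \<in> interior T \<Longrightarrow> w x = k x"
    using assms(2) T by (rule P1_affine_functional) blast
  show "\<exists>h. affine_functional h \<and> (\<forall>x\<in>interior T. v x + c * w x = h x)"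
    using affine_functional_add_mult[OF h(1) k(1), of c] h(2) k(2)
    by (intro exI[of _ "\<lambda>x. h x + c * k x"]) simp
qed

section \<open>Conforming meshes: which simplices meet at a side\<close>

locale mesh =
  fixes \<Omega> :: "'a::euclidean_space set" and \<T> :: "'a set set" and \<nu> :: "'a set \<Rightarrow> 'a"
  assumes lipschitz: "lipschitz_domain \<Omega>"
    and triangulation: "triangulation_of \<T> \<Omega>"
    and normals: "side_normals \<T> \<nu>"
begin

lemma finite_\<T>: "finite \<T>"
  and simplex_\<T>: "T \<in> \<T> \<Longrightarrow> int DIM('a) simplex T"
  and face_Int: "T \<in> \<T> \<Longrightarrow> T' \<in> \<T> \<Longrightarrow> (T \<inter> T') face_of T"
  and Union_\<T>: "\<Union>\<T> = closure \<Omega>"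
  using triangulation unfolding triangulation_of_def triangulation_def by blast+

lemma open_\<Omega>: "open \<Omega>"
  using lipschitz unfolding lipschitz_domain_def by blast

lemma solid_simplex_\<T>: "T \<in> \<T> \<Longrightarrow> solid_simplex T"
  by standard (rule simplex_\<T>)

lemma interior_disjoint:
  assumes "T \<in> \<T>" "T' \<in> \<T>" "T \<noteq> T'"
  shows "interior T \<inter> interior T' = {}"
proof (rule ccontr)
  assume "\<not> ?thesis"
  then obtain x where x: "x \<in> interior T" "x \<in> interior T'" by blast
  then have "x \<in> T" "x \<in> T'" using interior_subset by blast+
  then have "T \<inter> T' = T" "T' \<inter> T = T'"
    using face_of_disjoint_interior[OF face_Int[OF assms(1,2)]]
      face_of_disjoint_interior[OF face_Int[OF assms(2,1)]] x by blast+
  with assms(3) show False by blast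
qed

text \<open>\<open>T \<inter> T'\<close> is a face of \<open>T\<close> meeting the relative interior
  of \<open>E\<close>, so it contains \<open>E\<close>; being also a face of \<open>T'\<close>, it
  passes the face relation on. This is how conformity excludes hanging nodes.\<close>

lemma facet_of_neighbour:
  assumes "T \<in> \<T>" "T' \<in> \<T>" "E facet_of T" "p \<in> rel_interior E" "p \<in> T'"
  shows "E facet_of T'"
proof -
  have E: "E face_of T" "E \<subseteq> T" "E \<noteq> {}" "aff_dim E = aff_dim T - 1"
    using assms(3) by (auto simp: facet_of_def face_of_imp_subset)
  have "p \<in> (T \<inter> T') \<inter> rel_interior E"
    using assms(4,5) rel_interior_subset E(2) by blast
  then have sub: "E \<subseteq> T \<inter> T'"
    using subset_of_face_of[OF face_Int[OF assms(1,2)] E(2)] by blast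
  have "E face_of T \<inter> T'"
    using E(1) sub by (rule face_of_subset) blast
  moreover have "T \<inter> T' face_of T'"
    using face_Int[OF assms(2,1)] by (simp add: Int_commute)
  ultimately have "E face_of T'" by (rule face_of_trans)
  moreover have "aff_dim T = aff_dim T'"
    using aff_dim_simplex[OF simplex_\<T>] assms(1,2) by simp
  ultimately show ?thesis
    using E unfolding facet_of_def by simp
qed

definition adjacent :: "'a set \<Rightarrow> 'a set set" where
  "adjacent E = {T \<in> \<T>. E facet_of T}"

lemma finite_adjacent: "finite (adjacent E)"
  using finite_\<T> by (simp add: adjacent_def)

lemma sides_iff_adjacent: "E \<in> sides \<T> \<longleftrightarrow> adjacent E \<noteq> {}"
  by (auto simp: sides_def sides_of_def adjacent_def)

lemma finite_sides_of: "T \<in> \<T> \<Longrightarrow> finite (sides_of T)"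
proof -
  assume "T \<in> \<T>"
  then interpret solid_simplex T by (rule solid_simplex_\<T>)
  have "sides_of T \<subseteq> opposite ` vertices T"
    unfolding sides_of_def facet_iff by blast
  then show ?thesis using finite_vertices by (rule finite_subset[OF _ finite_imageI])
qed

lemma finite_sides: "finite (sides \<T>)"
  using finite_\<T> finite_sides_of by (simp add: sides_def)

lemma side_simplex:
  assumes "E \<in> sides \<T>"
  shows "flat_simplex (vertices E)" "convex hull (vertices E) = E"
proof -
  obtain T where "T \<in> \<T>" "E facet_of T"
    using assms by (auto simp: sides_iff_adjacent adjacent_def)
  then show "flat_simplex (vertices E)" "convex hull (vertices E) = E"
    using solid_simplex.facet_convex_hull[OF solid_simplex_\<T>] by metis+
qed

lemma area_side_pos: "E \<in> sides \<T> \<Longrightarrow> 0 < area E"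
  using flat_simplex.area_pos[OF side_simplex(1)] side_simplex(2) by simp

lemma mid_side: "E \<in> sides \<T> \<Longrightarrow> mid E \<in> rel_interior E"
  using flat_simplex.mid_in_rel_interior[OF side_simplex(1)] side_simplex(2) by simp

text \<open>As the barycenter is a relative interior point, a simplex containing it has the whole
  side as a facet. Limits at \<open>mid E\<close> thus see only the adjacent simplices.\<close>

lemma mid_mem_iff_adjacent:
  assumes "E \<in> sides \<T>" "T \<in> \<T>"
  shows "mid E \<in> T \<longleftrightarrow> T \<in> adjacent E"
proof
  obtain T' where "T' \<in> \<T>" "E facet_of T'"
    using assms by (auto simp: sides_iff_adjacent adjacent_def)
  then show "mid E \<in> T \<Longrightarrow> T \<in> adjacent E"
    using facet_of_neighbour[OF _ assms(2) _ mid_side[OF assms(1)]] assms(2)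
    by (auto simp: adjacent_def)
  show "T \<in> adjacent E \<Longrightarrow> mid E \<in> T"
    using mid_side[OF assms(1)] rel_interior_subset facet_of_imp_subset
    by (fastforce simp: adjacent_def)
qed

text \<open>If a relative interior point of \<open>E\<close> were in \<open>\<Omega>\<close>,
  removing the finitely many other closed simplices would leave an open neighbourhood inside
  \<open>T\<close>; but a proper face contains no interior point of \<open>T\<close>.\<close>

lemma single_adjacent_frontier:
  assumes "adjacent E = {T}"
  shows "E \<subseteq> frontier \<Omega>"
proof -
  have T: "T \<in> \<T>" "E facet_of T" using assms by (auto simp: adjacent_def)
  have E: "E \<in> sides \<T>" using assms by (simp add: sides_iff_adjacent)
  have "p \<in> frontier \<Omega>" if p: "p \<in> rel_interior E" for p
  proof -
    have "p \<in> T"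
      using p rel_interior_subset[of E] facet_of_imp_subset[OF T(2)] by blast
    have "p \<notin> \<Omega>"
    proof
      assume "p \<in> \<Omega>"
      let ?U = "\<Omega> - \<Union>(\<T> - {T})"
      have "closed (\<Union>(\<T> - {T}))"
        using finite_\<T> closed_simplex[OF simplex_\<T>] by (intro closed_Union) auto
      then have "open ?U" using open_\<Omega> by (rule open_Diff[rotated])
      moreover have "p \<notin> T'" if "T' \<in> \<T> - {T}" for T'
      proof
        assume "p \<in> T'"
        then have "T' \<in> adjacent E"
          using facet_of_neighbour[OF T(1) _ T(2) p] that by (auto simp: adjacent_def)
        with assms that show False by blast
      qed
      then have "p \<in> ?U" using \<open>p \<in> \<Omega>\<close> by blast
      moreover have "?U \<subseteq> T"
        using Union_\<T> closure_subset[of \<Omega>] by blast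
      ultimately have "p \<in> interior T" by (rule interiorI)
      moreover have "p \<in> E" using p rel_interior_subset by blast
      moreover have "E \<noteq> T" using T(2) by auto
      ultimately show False
        using face_of_disjoint_interior[OF facet_of_imp_face_of[OF T(2)]] by blast
    qed
    moreover have "p \<in> closure \<Omega>" using \<open>p \<in> T\<close> T(1) Union_\<T> by blast
    ultimately show ?thesis
      using open_\<Omega> by (simp add: frontier_def interior_open)
  qed
  \<comment> \<open>The frontier is closed, so the claim extends from the relative interior to all
    of \<open>E\<close>.\<close>
  then have "closure (rel_interior E) \<subseteq> frontier \<Omega>"
    by (intro closure_minimal) auto
  moreover have "convex E"
    using side_simplex(2)[OF E] convex_convex_hull by metis
  ultimately show ?thesis
    using convex_closure_rel_interior closure_subset[of E] by blast
qed

text \<open>The two simplices cover a neighbourhood of \<open>mid E\<close> within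
  \<open>closure \<Omega>\<close>, and the interior of that closure lies in
  \<open>\<Omega>\<close>.\<close>

lemma two_adjacent:
  assumes "T \<in> adjacent E" "T' \<in> adjacent E" "T \<noteq> T'"
  shows two_adjacent_normal: "outer_normal T' E = - outer_normal T E"
    and two_adjacent_mid: "mid E \<in> \<Omega>"
proof -
  have T: "T \<in> \<T>" "T' \<in> \<T>" "E facet_of T" "E facet_of T'"
    using assms by (auto simp: adjacent_def)
  note * = simplices_sharing_facet[OF simplex_\<T>[OF T(1)] simplex_\<T>[OF T(2)] T(3,4)
      interior_disjoint[OF T(1,2) assms(3)]]
  show "outer_normal T' E = - outer_normal T E" by (rule *(1))
  have "T \<union> T' \<subseteq> closure \<Omega>" using T Union_\<T> by blast
  then show "mid E \<in> \<Omega>"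
    using *(2) interior_mono lipschitz_domain_interior_closure[OF lipschitz] by blast
qed

lemma norm_outer_normal_adjacent: "T \<in> adjacent E \<Longrightarrow> norm (outer_normal T E) = 1"
  using solid_simplex.norm_outer_normal[OF solid_simplex_\<T>] by (auto simp: adjacent_def)

text \<open>Any two adjacent simplices have opposite normals, so a third would have a unit normal
  equal to its own negative.\<close>

lemma adjacent_cases:
  assumes "E \<in> sides \<T>"
  obtains (boundary) T where "adjacent E = {T}" "E \<subseteq> frontier \<Omega>"
  | (interior) T T' where "adjacent E = {T, T'}" "T \<noteq> T'" "\<not> E \<subseteq> frontier \<Omega>"
proof -
  obtain T where T: "T \<in> adjacent E" using assms sides_iff_adjacent by blast
  show thesis
  proof (cases "adjacent E = {T}")
    case True
    then show thesis by (rule boundary) (rule single_adjacent_frontier[OF True])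
  next
    case False
    then obtain T' where T': "T' \<in> adjacent E" "T \<noteq> T'" using T by blast
    have "T'' = T \<or> T'' = T'" if T'': "T'' \<in> adjacent E" for T''
    proof (rule ccontr)
      assume "\<not> (T'' = T \<or> T'' = T')"
      then have "outer_normal T'' E = - outer_normal T E" "outer_normal T'' E = - outer_normal T' E"
        using two_adjacent_normal T T' T'' by metis+
      moreover have "outer_normal T' E = - outer_normal T E"
        using two_adjacent_normal T T' by metis
      ultimately have "outer_normal T E = - outer_normal T E" by simp
      then have "2 *\<^sub>R outer_normal T E = 0"
        unfolding scaleR_2 eq_neg_iff_add_eq_0 .
      then have "outer_normal T E = 0" by simp
      with norm_outer_normal_adjacent[OF T] show False by simp
    qed
    then have "adjacent E = {T, T'}" using T T' by blast
    moreover have "\<not> E \<subseteq> frontier \<Omega>"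
    proof -
      have "mid E \<in> \<Omega>" using two_adjacent_mid[OF T T'] .
      then have "mid E \<notin> frontier \<Omega>" using open_\<Omega> by (simp add: frontier_def interior_open)
      moreover have "mid E \<in> E" using mid_side[OF assms] rel_interior_subset by blast
      ultimately show ?thesis by blast
    qed
    ultimately show thesis using T'(2) interior by blast
  qed
qed

definition orient :: "'a set \<Rightarrow> 'a set \<Rightarrow> real" where
  "orient T E = outer_normal T E \<bullet> \<nu> E"

text \<open>\<open>\<nu> E\<close> is the outer normal of one adjacent simplex, so the sign is 1
  there and -1 on any other.\<close>

lemma orient_props:
  assumes "E \<in> sides \<T>"
  shows orient_square: "T \<in> adjacent E \<Longrightarrow> orient T E * orient T E = 1"
    and orient_opposite: "T \<in> adjacent E \<Longrightarrow> T' \<in> adjacent E \<Longrightarrow> T \<noteq> T' \<Longrightarrow> orient T' E = - orient T E"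
proof -
  obtain S where S: "S \<in> adjacent E" "\<nu> E = outer_normal S E"
    using normals assms unfolding side_normals_def adjacent_def sides_of_def by auto
  have one: "outer_normal S E \<bullet> outer_normal S E = 1"
    using norm_outer_normal_adjacent[OF S(1)] by (simp add: norm_eq_1)
  show "orient T E * orient T E = 1" if "T \<in> adjacent E"
  proof (cases "T = S")
    case False
    then have "outer_normal T E = - outer_normal S E"
      using two_adjacent_normal[OF S(1) that] by simp
    then show ?thesis using one by (simp add: orient_def S(2))
  qed (simp add: orient_def S(2) one)
  show "orient T' E = - orient T E" if "T \<in> adjacent E" "T' \<in> adjacent E" "T \<noteq> T'"
    using two_adjacent_normal[OF that] by (simp add: orient_def)
qed

lemma side_trace_mid:
  assumes "affine_functional h" "\<And>x. x \<in> interior T \<Longrightarrow> v x = h x" "E \<in> sides \<T>" "T \<in> adjacent E"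
  shows "side_trace T v (mid E) = h (mid E)"
proof -
  have "T \<in> \<T>" "mid E \<in> T" using assms(3,4) mid_mem_iff_adjacent by (auto simp: adjacent_def)
  then show ?thesis
    using solid_simplex.side_trace_eq[OF solid_simplex_\<T> assms(1,2)] by simp
qed

section \<open>Jumps at barycenters and the Crouzeix-Raviart condition\<close>

definition jump :: "'a set \<Rightarrow> ('a \<Rightarrow> real) \<Rightarrow> real" where
  "jump E v = (\<Sum>T\<in>adjacent E. orient T E * side_trace T v (mid E))"

text \<open>The limit splits over the simplices. Those away from \<open>mid E\<close> contribute the
  trivial filter, on which every limit holds; on an adjacent one the limit exists and is the
  trace.\<close>

lemma tendsto_skeleton_iff:
  assumes "v \<in> P1 \<T>" "E \<in> sides \<T>"
  shows "(v \<longlongrightarrow> l) (at (mid E) within (\<Union>T\<in>\<T>. interior T))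
           \<longleftrightarrow> (\<forall>T\<in>adjacent E. side_trace T v (mid E) = l)"
proof -
  have adj: "(v \<longlongrightarrow> l) (at (mid E) within interior T) \<longleftrightarrow> side_trace T v (mid E) = l"
    if T: "T \<in> adjacent E" for T
  proof -
    have T': "T \<in> \<T>" using T by (simp add: adjacent_def)
    have m: "mid E \<in> T" using T T' mid_mem_iff_adjacent[OF assms(2)] by blast
    obtain h where h: "affine_functional h" "\<And>x. x \<in> interior T \<Longrightarrow> v x = h x"
      using assms(1) T' by (rule P1_affine_functional) blast
    note tr = solid_simplex.trace_limit[OF solid_simplex_\<T>[OF T'] h m]
    show ?thesis
    proof
      assume "(v \<longlongrightarrow> l) (at (mid E) within interior T)"
      then have "l = h (mid E)" using tr(1) tendsto_unique[OF tr(2)] by blast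
      then show "side_trace T v (mid E) = l" using tr(3) by simp
    next
      assume "side_trace T v (mid E) = l"
      then show "(v \<longlongrightarrow> l) (at (mid E) within interior T)" using tr(1,3) by simp
    qed
  qed
  have nadj: "(v \<longlongrightarrow> l) (at (mid E) within interior T)" if "T \<in> \<T> - adjacent E" for T
  proof -
    have "mid E \<notin> T" using that mid_mem_iff_adjacent[OF assms(2)] by blast
    then have "mid E \<notin> closure (interior T)"
      using solid_simplex.closure_interior_T[OF solid_simplex_\<T>] that by simp
    then have "at (mid E) within interior T = bot"
      by (rule not_in_closure_trivial_limitI)
    then show ?thesis by simp
  qed
  have "adjacent E \<subseteq> \<T>" by (auto simp: adjacent_def)
  then show ?thesis
    unfolding tendsto_within_UN_finite[OF finite_\<T>] using adj nadj by blast
qed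

text \<open>On a boundary side the jump is the single trace up to sign. On an interior side the
  opposite signs turn it into a difference of traces, and a common limit exists exactly when these
  agree.\<close>

lemma CR10_iff_jump:
  assumes v: "v \<in> P1 \<T>"
  shows "v \<in> CR10 \<Omega> \<T> \<longleftrightarrow> (\<forall>E\<in>sides \<T>. jump E v = 0)"
proof -
  have "(if E \<subseteq> frontier \<Omega> then (v \<longlongrightarrow> 0) (at (mid E) within (\<Union>T\<in>\<T>. interior T))
      else (\<exists>l. (v \<longlongrightarrow> l) (at (mid E) within (\<Union>T\<in>\<T>. interior T)))) \<longleftrightarrow> jump E v = 0"
    if E: "E \<in> sides \<T>" for E
    using E
  proof (cases rule: adjacent_cases)
    case (boundary T)
    have "orient T E \<noteq> 0" using orient_square[OF E, of T] boundary(1) by auto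
    then show ?thesis
      using boundary by (simp add: tendsto_skeleton_iff[OF v E] jump_def)
  next
    case (interior T T')
    have s: "orient T E \<noteq> 0" "orient T' E = - orient T E"
      using orient_square[OF E, of T] orient_opposite[OF E, of T T'] interior(1,2) by auto
    have "jump E v = orient T E * (side_trace T v (mid E) - side_trace T' v (mid E))"
      using interior(1,2) by (simp add: jump_def s(2) algebra_simps)
    then show ?thesis
      using interior s(1) by (auto simp: tendsto_skeleton_iff[OF v E])
  qed
  then show ?thesis
    using v unfolding CR10_def by simp
qed

text \<open>Membership in \<open>P1\<close> makes the traces genuine limits; \<open>Lim\<close> by
  itself is not additive.\<close>

lemma jump_add_mult:
  assumes "v \<in> P1 \<T>" "w \<in> P1 \<T>" "E \<in> sides \<T>"
  shows "jump E (\<lambda>x. v x + c * w x) = jump E v + c * jump E w"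
proof -
  have "side_trace T (\<lambda>x. v x + c * w x) (mid E) = side_trace T v (mid E) + c * side_trace T w (mid E)"
    if T: "T \<in> adjacent E" for T
  proof -
    have T': "T \<in> \<T>" using T by (simp add: adjacent_def)
    obtain h where h: "affine_functional h" "\<And>x. x \<in> interior T \<Longrightarrow> v x = h x"
      using assms(1) T' by (rule P1_affine_functional) blast
    obtain k where k: "affine_functional k" "\<And>x. x \<in> interior T \<Longrightarrow> w x = k x"
      using assms(2) T' by (rule P1_affine_functional) blast
    show ?thesis
      using side_trace_mid[OF h assms(3) T] side_trace_mid[OF k assms(3) T]
        side_trace_mid[OF affine_functional_add_mult[OF h(1) k(1)] _ assms(3) T, of "\<lambda>x. v x + c * w x" c]
        h(2) k(2) by simp
  qed
  then have "jump E (\<lambda>x. v x + c * w x)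
      = (\<Sum>T\<in>adjacent E. orient T E * side_trace T v (mid E) + c * (orient T E * side_trace T w (mid E)))"
    unfolding jump_def by (intro sum.cong) (auto simp: algebra_simps)
  then show ?thesis
    by (simp add: jump_def sum.distrib sum_distrib_left)
qed

text \<open>On a simplex with side \<open>E\<close> and opposite vertex \<open>z\<close>, the function \<open>1 - n \<lambda>\<^sub>z\<close> is \<open>1\<close> at the
  barycenter of \<open>E\<close> and \<open>0\<close> at those of the other sides.\<close>

lemma jump_dual_basis:
  assumes "E \<in> sides \<T>"
  obtains \<eta> where "\<eta> \<in> P1 \<T>" "\<And>E'. E' \<in> sides \<T> \<Longrightarrow> jump E' \<eta> = (if E' = E then 1 else 0)"
proof -
  obtain T where T: "T \<in> adjacent E" using assms sides_iff_adjacent by blast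
  then have T': "T \<in> \<T>" "E facet_of T" by (auto simp: adjacent_def)
  interpret solid_simplex T using T'(1) by (rule solid_simplex_\<T>)
  obtain z where z: "z \<in> vertices T" "E = opposite z" using T'(2) facet_iff by blast
  \<comment> \<open>The factor \<open>orient T E\<close> cancels the sign in the jump, because its
    square is 1.\<close>
  define k where "k x = orient T E + (- (orient T E * DIM('a))) * bar z x" for x
  have k: "affine_functional k"
    unfolding k_def using affine_functional_add_mult[OF affine_functionalI[of 0 "orient T E"] affine_functional_bar[OF z(1)],
        of "- (orient T E * DIM('a))"]
    by simp
  \<comment> \<open>Since \<open>P1\<close> imposes no continuity, extension by zero is allowed, and
    each jump sees at most the trace from \<open>T\<close>.\<close>
  define \<eta> where "\<eta> x = (if x \<in> interior T then k x else 0)" for x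
  have zero: "\<eta> x = 0" if "S \<in> \<T>" "S \<noteq> T" "x \<in> interior S" for S x
    using interior_disjoint[OF that(1) T'(1) that(2)] that(3) by (auto simp: \<eta>_def)
  have zero_aff: "affine_functional (\<lambda>x. 0 :: real)"
    using affine_functionalI[of 0 0] by simp
  have "\<eta> \<in> P1 \<T>"
    unfolding P1_iff_affine_functional
  proof
    fix S assume "S \<in> \<T>"
    show "\<exists>h. affine_functional h \<and> (\<forall>x\<in>interior S. \<eta> x = h x)"
    proof (cases "S = T")
      case True
      then show ?thesis using k by (intro exI[of _ k]) (simp add: \<eta>_def)
    next
      case False
      then show ?thesis using zero_aff zero[OF \<open>S \<in> \<T>\<close>] by blast
    qed
  qed
  moreover have "jump E' \<eta> = (if E' = E then 1 else 0)" if E': "E' \<in> sides \<T>" for E'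
  proof -
    have tr: "side_trace S \<eta> (mid E') = (if S = T then k (mid E') else 0)" if S: "S \<in> adjacent E'" for S
    proof (cases "S = T")
      case True
      then show ?thesis
        using side_trace_mid[OF k _ E' S, of \<eta>] by (simp add: \<eta>_def)
    next
      case False
      have "S \<in> \<T>" using S by (simp add: adjacent_def)
      then show ?thesis
        using side_trace_mid[OF zero_aff zero[OF _ False] E' S] False by simp
    qed
    have "jump E' \<eta> = (\<Sum>S\<in>adjacent E'. if S = T then orient T E' * k (mid E') else 0)"
      unfolding jump_def by (rule sum.cong) (auto simp: tr)
    also have "\<dots> = (if T \<in> adjacent E' then orient T E' * k (mid E') else 0)"
      by (simp add: finite_adjacent)
    also have "\<dots> = (if E' = E then 1 else 0)"
    proof (cases "T \<in> adjacent E'")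
      case True
      then have "E' facet_of T" by (simp add: adjacent_def)
      then obtain z' where z': "z' \<in> vertices T" "E' = opposite z'" using facet_iff by blast
      have "bar z (mid E') = (if E' = E then 0 else 1 / DIM('a))"
        using bar_mid_opposite[OF z'(1) z(1)] opposite_inject[OF z(1) z'(1)] z(2) z'(2) by auto
      then show ?thesis
        using True orient_square[OF assms T] by (simp add: k_def)
    next
      case False
      then show ?thesis using T by auto
    qed
    finally show ?thesis .
  qed
  ultimately show thesis by (rule that)
qed

text \<open>The traces on a side are affine, so the midpoint rule evaluates each integral;
  exchanging the sums over simplices and sides then collects the jumps.\<close>

lemma skeleton_pairing_eq:
  assumes v: "v \<in> P1 \<T>"
  shows "skeleton_pairing \<T> \<nu> t v = (\<Sum>E\<in>sides \<T>. t E * area E * jump E v)"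
proof -
  have int: "(LINT x:E|flat_measure E. t E * side_trace T v x) = t E * area E * side_trace T v (mid E)"
    if T: "T \<in> \<T>" and E: "E \<in> sides_of T" for T E
  proof -
    have E': "E facet_of T" "E \<in> sides \<T>" using T E by (auto simp: sides_def sides_of_def)
    obtain h where h: "affine_functional h" "\<And>x. x \<in> interior T \<Longrightarrow> v x = h x"
      using v T by (rule P1_affine_functional) blast
    interpret F: flat_simplex "vertices E" using E'(2) by (rule side_simplex)
    note hull = side_simplex(2)[OF E'(2)]
    have tr: "side_trace T v x = h x" if "x \<in> E" for x
      using solid_simplex.side_trace_eq[OF solid_simplex_\<T>[OF T] h, of x]
        facet_of_imp_subset[OF E'(1)] that by blast
    have "(LINT x:E|flat_measure E. t E * side_trace T v x) = (LINT x:E|flat_measure E. t E * h x)"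
      unfolding set_lebesgue_integral_def
      by (intro Bochner_Integration.integral_cong) (auto simp: tr indicator_def)
    also have "\<dots> = t E * (area E * h (mid E))"
      using F.integral_affine[OF h(1)] unfolding hull by simp
    also have "h (mid E) = side_trace T v (mid E)"
      using tr mid_side[OF E'(2)] rel_interior_subset by fastforce
    finally show ?thesis by simp
  qed
  have "skeleton_pairing \<T> \<nu> t v
      = (\<Sum>T\<in>\<T>. \<Sum>E\<in>sides_of T. t E * area E * (orient T E * side_trace T v (mid E)))"
    unfolding skeleton_pairing_def orient_def by (intro sum.cong refl) (simp only: int mult_ac)
  also have "\<dots> = (\<Sum>T\<in>\<T>. \<Sum>E | E \<in> sides \<T> \<and> E facet_of T.
      t E * area E * (orient T E * side_trace T v (mid E)))"
    by (intro sum.cong refl) (auto simp: sides_def sides_of_def)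
  also have "\<dots> = (\<Sum>E\<in>sides \<T>. \<Sum>T | T \<in> \<T> \<and> E facet_of T.
      t E * area E * (orient T E * side_trace T v (mid E)))"
    by (rule sum.swap_restrict[OF finite_\<T> finite_sides])
  also have "\<dots> = (\<Sum>E\<in>sides \<T>. t E * area E * jump E v)"
    by (simp add: jump_def adjacent_def sum_distrib_left)
  finally show ?thesis .
qed

end

subsection \<open>The discrete problems\<close>

lemma grad_eqI:
  assumes "GDERIV f x :> D"
  shows "grad f x = D"
  unfolding grad_def
proof (rule the_equality[where P = "\<lambda>D. GDERIV f x :> D"])
  fix D' assume "GDERIV f x :> D'"
  then have "(\<lambda>h. h \<bullet> D') = (\<lambda>h. h \<bullet> D)"
    using assms unfolding gderiv_def by (rule has_derivative_unique)
  then have "\<forall>h. D' \<bullet> h = D \<bullet> h" by (metis inner_commute)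
  then show "D' = D" by (simp add: vector_eq_rdot)
qed (fact assms)

lemma grad_affine_on_open:
  assumes "open S" "x \<in> S" "\<And>y. y \<in> S \<Longrightarrow> f y = a \<bullet> y + c"
  shows "grad f x = a"
proof (rule grad_eqI)
  have "((\<lambda>y. a \<bullet> y + c) has_derivative (\<lambda>h. h \<bullet> a)) (at x)"
    by (auto intro!: derivative_eq_intros simp: inner_commute)
  then show "GDERIV f x :> a"
    unfolding gderiv_def
    by (rule has_derivative_transform_within_open[OF _ assms(1,2)]) (simp add: assms(3))
qed

lemma (in finite_measure) integrable_if_square_integrable:
  fixes u :: "'a \<Rightarrow> 'b::{banach, second_countable_topology}"
  assumes "u \<in> borel_measurable M" "integrable M (\<lambda>x. (norm (u x))\<^sup>2)"
  shows "integrable M u"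
proof (rule Bochner_Integration.integrable_bound)
  show "integrable M (\<lambda>x. 1 + (norm (u x))\<^sup>2)"
    using assms(2) by (intro Bochner_Integration.integrable_add integrable_const)
  have "r \<le> 1 + r\<^sup>2" for r :: real
    using zero_le_power2[of "r - 1/2"] by (simp add: power2_eq_square algebra_simps)
  then show "AE x in M. norm (u x) \<le> norm (1 + (norm (u x))\<^sup>2)"
    by (intro AE_I2) auto
qed (fact assms(1))

section \<open>Functionals on piecewise affine functions as skeleton pairings\<close>

context mesh
begin

definition linear_on_P1 :: "(('a \<Rightarrow> real) \<Rightarrow> real) \<Rightarrow> bool" where
  "linear_on_P1 G \<longleftrightarrow>
     (\<forall>v\<in>P1 \<T>. \<forall>w\<in>P1 \<T>. \<forall>c. G (\<lambda>x. v x + c * w x) = G v + c * G w)"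

text \<open>Membership in \<open>P1\<close> is carried through the induction because linearity is
  available only there.\<close>

lemma linear_on_P1_sum:
  assumes G: "linear_on_P1 G" and v: "v \<in> P1 \<T>"
    and A: "finite A" "\<And>E. E \<in> A \<Longrightarrow> \<beta> E \<in> P1 \<T>"
  shows "(\<lambda>x. v x + (\<Sum>E\<in>A. c E * \<beta> E x)) \<in> P1 \<T> \<and>
         G (\<lambda>x. v x + (\<Sum>E\<in>A. c E * \<beta> E x)) = G v + (\<Sum>E\<in>A. c E * G (\<beta> E))"
  using A
proof induction
  case (insert E A)
  let ?w = "\<lambda>x. v x + (\<Sum>E\<in>A. c E * \<beta> E x)"
  have IH: "?w \<in> P1 \<T>" "G ?w = G v + (\<Sum>E\<in>A. c E * G (\<beta> E))" and \<beta>: "\<beta> E \<in> P1 \<T>"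
    using insert by auto
  have eq: "(\<lambda>x. v x + (\<Sum>E\<in>insert E A. c E * \<beta> E x)) = (\<lambda>x. ?w x + c E * \<beta> E x)"
    using insert by (simp add: algebra_simps)
  have "(\<lambda>x. ?w x + c E * \<beta> E x) \<in> P1 \<T>"
    using IH(1) \<beta> by (rule P1_add_mult)
  moreover have "G (\<lambda>x. ?w x + c E * \<beta> E x) = G ?w + c E * G (\<beta> E)"
    by (rule G[unfolded linear_on_P1_def, rule_format, OF IH(1) \<beta>])
  ultimately show ?case
    unfolding eq using IH(2) insert by simp
qed (use v in simp)

lemma linear_on_P1_jump: "E \<in> sides \<T> \<Longrightarrow> linear_on_P1 (jump E)"
  unfolding linear_on_P1_def using jump_add_mult by blast

lemma P0_sides_eqI:
  assumes "t \<in> P0_sides \<T>" "t' \<in> P0_sides \<T>" "\<And>E. E \<in> sides \<T> \<Longrightarrow> t E = t' E"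
  shows "t = t'"
  using assms unfolding P0_sides_def by (rule PiE_ext)

text \<open>The jumps are coordinates on \<open>P1 \<T>\<close> modulo \<open>CR10 \<Omega> \<T>\<close>, so the functionals that vanish
  on \<open>CR10 \<Omega> \<T>\<close> are exactly the pairings with the functions in \<open>P0_sides \<T>\<close>.\<close>

lemma pairing_representation:
  assumes G: "linear_on_P1 G" and zero: "\<And>w. w \<in> CR10 \<Omega> \<T> \<Longrightarrow> G w = 0"
  shows "\<exists>!t. t \<in> P0_sides \<T> \<and> (\<forall>v\<in>P1 \<T>. skeleton_pairing \<T> \<nu> t v = G v)"
proof -
  have "\<forall>E\<in>sides \<T>. \<exists>\<eta>. \<eta> \<in> P1 \<T> \<and> (\<forall>E'\<in>sides \<T>. jump E' \<eta> = (if E' = E then 1 else 0))"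
    by (metis jump_dual_basis)
  then obtain \<beta> where "\<forall>E\<in>sides \<T>. \<beta> E \<in> P1 \<T> \<and>
      (\<forall>E'\<in>sides \<T>. jump E' (\<beta> E) = (if E' = E then 1 else 0))"
    by (rule bchoice[THEN exE])
  then have \<beta>: "\<And>E. E \<in> sides \<T> \<Longrightarrow> \<beta> E \<in> P1 \<T>"
    and jump_\<beta>: "\<And>E E'. E \<in> sides \<T> \<Longrightarrow> E' \<in> sides \<T> \<Longrightarrow> jump E' (\<beta> E) = (if E' = E then 1 else 0)"
    by auto
  have expand: "G v = (\<Sum>E\<in>sides \<T>. jump E v * G (\<beta> E))" if v: "v \<in> P1 \<T>" for v
  proof -
    \<comment> \<open>Subtracting the jumps of \<open>v\<close> along the dual basis leaves a
      function without jumps, on which \<open>G\<close> vanishes.\<close>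
    let ?w = "\<lambda>x. v x + (\<Sum>E\<in>sides \<T>. - jump E v * \<beta> E x)"
    have P1: "?w \<in> P1 \<T>" and Gw: "G ?w = G v + (\<Sum>E\<in>sides \<T>. - jump E v * G (\<beta> E))"
      using linear_on_P1_sum[OF G v finite_sides, where \<beta> = \<beta> and c = "\<lambda>E. - jump E v"] \<beta> by blast+
    have "jump E' ?w = 0" if E': "E' \<in> sides \<T>" for E'
    proof -
      have "jump E' ?w = jump E' v + (\<Sum>E\<in>sides \<T>. - jump E v * jump E' (\<beta> E))"
        using linear_on_P1_sum[OF linear_on_P1_jump[OF E'] v finite_sides, where \<beta> = \<beta> and c = "\<lambda>E. - jump E v"] \<beta>
        by blast
      also have "(\<Sum>E\<in>sides \<T>. - jump E v * jump E' (\<beta> E)) = (\<Sum>E\<in>sides \<T>. if E' = E then - jump E v else 0)"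
        by (rule sum.cong) (auto simp: jump_\<beta> E')
      also have "\<dots> = - jump E' v"
        using E' finite_sides by simp
      finally show ?thesis by simp
    qed
    then have "?w \<in> CR10 \<Omega> \<T>" using CR10_iff_jump[OF P1] by blast
    from zero[OF this] Gw show ?thesis by (simp add: sum_negf)
  qed
  show ?thesis
  proof (rule ex1I)
    \<comment> \<open>Division by the area cancels the weight that the midpoint rule puts on each
      side.\<close>
    let ?t = "\<lambda>E\<in>sides \<T>. G (\<beta> E) / area E"
    show "?t \<in> P0_sides \<T> \<and> (\<forall>v\<in>P1 \<T>. skeleton_pairing \<T> \<nu> ?t v = G v)"
    proof (intro conjI ballI)
      show "?t \<in> P0_sides \<T>" by (simp add: P0_sides_def)
      fix v assume v: "v \<in> P1 \<T>"
      have "skeleton_pairing \<T> \<nu> ?t v = (\<Sum>E\<in>sides \<T>. jump E v * G (\<beta> E))"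
        unfolding skeleton_pairing_eq[OF v]
      proof (rule sum.cong[OF refl])
        fix E assume E: "E \<in> sides \<T>"
        show "?t E * area E * jump E v = jump E v * G (\<beta> E)"
          using E area_side_pos[OF E] by simp
      qed
      then show "skeleton_pairing \<T> \<nu> ?t v = G v" using expand[OF v] by simp
    qed
    fix t assume t: "t \<in> P0_sides \<T> \<and> (\<forall>v\<in>P1 \<T>. skeleton_pairing \<T> \<nu> t v = G v)"
    show "t = ?t"
    proof (rule P0_sides_eqI)
      show "t \<in> P0_sides \<T>" "?t \<in> P0_sides \<T>" using t by (auto simp: P0_sides_def)
      fix E assume E: "E \<in> sides \<T>"
      \<comment> \<open>Testing with a dual basis function isolates the coefficient of one
        side.\<close>
      have "G (\<beta> E) = (\<Sum>E'\<in>sides \<T>. t E' * area E' * jump E' (\<beta> E))"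
        using t \<beta>[OF E] skeleton_pairing_eq[OF \<beta>[OF E], of t] by auto
      also have "\<dots> = (\<Sum>E'\<in>sides \<T>. if E' = E then t E' * area E' else 0)"
        by (rule sum.cong) (auto simp: jump_\<beta>[OF E])
      also have "\<dots> = t E * area E" using E finite_sides by simp
      finally show "t E = ?t E" using E area_side_pos[OF E] by simp
    qed
  qed
qed

lemma pairing_CR10:
  assumes "w \<in> CR10 \<Omega> \<T>"
  shows "skeleton_pairing \<T> \<nu> t w = 0"
proof -
  have "w \<in> P1 \<T>" using assms unfolding CR10_def by blast
  then show ?thesis
    using CR10_iff_jump[of w] assms by (simp add: skeleton_pairing_eq)
qed

lemma CR10_if_pairing_zero:
  assumes v: "v \<in> P1 \<T>" and zero: "\<And>s. s \<in> P0_sides \<T> \<Longrightarrow> skeleton_pairing \<T> \<nu> s v = 0"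
  shows "v \<in> CR10 \<Omega> \<T>"
  unfolding CR10_iff_jump[OF v]
proof
  fix E assume E: "E \<in> sides \<T>"
  let ?s = "\<lambda>E'\<in>sides \<T>. if E' = E then 1 else 0 :: real"
  have "?s \<in> P0_sides \<T>" by (simp add: P0_sides_def)
  from zero[OF this] have "0 = (\<Sum>E'\<in>sides \<T>. ?s E' * area E' * jump E' v)"
    by (simp add: skeleton_pairing_eq[OF v])
  also have "\<dots> = (\<Sum>E'\<in>sides \<T>. if E' = E then area E' * jump E' v else 0)"
    by (rule sum.cong) auto
  also have "\<dots> = area E * jump E v" using E finite_sides by simp
  finally show "jump E v = 0" using area_side_pos[OF E] by simp
qed

end

section \<open>Measurability and integrability in the volume terms\<close>

locale bounded_mesh = mesh +
  assumes bounded: "bounded \<Omega>"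
begin

lemma lmeasurable_\<Omega>: "\<Omega> \<in> lmeasurable"
  using bounded open_\<Omega> by (rule lmeasurable_open)

lemma \<Omega>_sets: "\<Omega> \<in> sets lebesgue"
  using lmeasurable_\<Omega> by blast

lemma finite_measure_\<Omega>: "finite_measure (lebesgue_on \<Omega>)"
  using fmeasurableD2[OF lmeasurable_\<Omega>] \<Omega>_sets
  by (intro finite_measureI) (simp add: emeasure_restrict_space)

text \<open>The simplex frontiers are finitely many frontiers of convex sets, hence null, so
  unprescribed skeleton values do not affect volume integrals.\<close>

lemma AE_interior: "AE x in lebesgue_on \<Omega>. \<exists>T\<in>\<T>. x \<in> interior T"
proof -
  have "negligible (\<Union>T\<in>\<T>. frontier T)"
    using finite_\<T> convex_simplex[OF simplex_\<T>]
    by (intro negligible_Union) (auto intro!: negligible_convex_frontier)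
  then have null: "(\<Union>T\<in>\<T>. frontier T) \<in> null_sets lebesgue"
    by (simp add: negligible_iff_null_sets)
  have "AE x in lebesgue. x \<in> \<Omega> \<longrightarrow> (\<exists>T\<in>\<T>. x \<in> interior T)"
  proof (rule AE_I'[OF null], clarify)
    fix x assume x: "x \<in> \<Omega>" "x \<notin> (\<Union>T\<in>\<T>. frontier T)"
    then obtain T where T: "T \<in> \<T>" "x \<in> T"
      using Union_\<T> closure_subset[of \<Omega>] by blast
    then have "x \<in> interior T"
      using x(2) closure_subset[of T] unfolding frontier_def by blast
    with T(1) show "\<exists>T\<in>\<T>. x \<in> interior T" by blast
  qed
  then show ?thesis
    using \<Omega>_sets by (simp add: AE_restrict_space_iff)
qed

text \<open>Off the skeleton \<open>F\<close> agrees with a Borel function glued from the continuous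
  pieces, and completeness of Lebesgue measure absorbs arbitrary skeleton values. The bound comes
  from compactness of the simplices.\<close>

lemma piecewise_continuous:
  fixes F :: "'a \<Rightarrow> 'b::euclidean_space"
  assumes "\<And>T. T \<in> \<T> \<Longrightarrow> \<exists>h. continuous_on UNIV h \<and> (\<forall>x\<in>interior T. F x = h x)"
  shows piecewise_continuous_measurable: "F \<in> borel_measurable (lebesgue_on \<Omega>)"
    and piecewise_continuous_bounded: "\<exists>K. AE x in lebesgue_on \<Omega>. norm (F x) \<le> K"
proof -
  have "\<forall>T\<in>\<T>. \<exists>h. continuous_on UNIV h \<and> (\<forall>x\<in>interior T. F x = h x)"
    using assms by blast
  then obtain H where "\<forall>T\<in>\<T>. continuous_on UNIV (H T) \<and> (\<forall>x\<in>interior T. F x = H T x)"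
    by (rule bchoice[THEN exE])
  then have H: "\<And>T. T \<in> \<T> \<Longrightarrow> continuous_on UNIV (H T)"
    "\<And>T x. T \<in> \<T> \<Longrightarrow> x \<in> interior T \<Longrightarrow> F x = H T x" by auto
  define g where "g x = (\<Sum>T\<in>\<T>. indicat_real (interior T) x *\<^sub>R H T x)" for x
  have g: "g x = F x" if "T \<in> \<T>" "x \<in> interior T" for x T
  proof -
    have "g x = (\<Sum>S\<in>\<T>. if S = T then F x else 0)"
      unfolding g_def
    proof (rule sum.cong[OF refl])
      fix S assume S: "S \<in> \<T>"
      show "indicat_real (interior S) x *\<^sub>R H S x = (if S = T then F x else 0)"
      proof (cases "S = T")
        case False
        then have "x \<notin> interior S"
          using interior_disjoint[OF S that(1)] that(2) by blast
        with False show ?thesis by simp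
      qed (use that H(2) in simp)
    qed
    then show ?thesis using that(1) finite_\<T> by simp
  qed
  have "g \<in> borel_measurable borel"
    unfolding g_def using H(1)
    by (intro borel_measurable_sum borel_measurable_scaleR borel_measurable_indicator
        borel_measurable_continuous_onI) auto
  then have "g \<in> borel_measurable (lebesgue_on \<Omega>)"
    by (intro measurable_restrict_space1 measurable_completion) simp
  then have "(\<lambda>x. if x \<in> \<Omega> then g x else 0) \<in> borel_measurable lebesgue"
    using \<Omega>_sets by (rule borel_measurable_if_I)
  moreover have "AE x in lebesgue. (if x \<in> \<Omega> then g x else 0) = (if x \<in> \<Omega> then F x else 0)"
  proof -
    have "AE x in lebesgue. x \<in> \<Omega> \<longrightarrow> (\<exists>T\<in>\<T>. x \<in> interior T)"
      using AE_interior \<Omega>_sets by (simp add: AE_restrict_space_iff)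
    then show ?thesis
      by eventually_elim (use g in auto)
  qed
  ultimately have "(\<lambda>x. if x \<in> \<Omega> then F x else 0) \<in> borel_measurable lebesgue"
    by (rule borel_measurable_AE)
  then show "F \<in> borel_measurable (lebesgue_on \<Omega>)"
    by (rule borel_measurable_if_D)
  have "\<exists>K\<ge>0. \<forall>x\<in>T. norm (H T x) \<le> K" if T: "T \<in> \<T>" for T
  proof -
    have "compact (H T ` T)"
      using continuous_on_subset[OF H(1)[OF T] subset_UNIV] compact_simplex[OF simplex_\<T>[OF T]]
      by (rule compact_continuous_image)
    then have "Elementary_Metric_Spaces.bounded (H T ` T)" by (rule compact_imp_bounded)
    then obtain K where "0 < K" "\<forall>y\<in>H T ` T. norm y \<le> K"
      unfolding bounded_pos by blast
    then show ?thesis by (intro exI[of _ K]) auto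
  qed
  then have "\<forall>T\<in>\<T>. \<exists>K. 0 \<le> K \<and> (\<forall>x\<in>T. norm (H T x) \<le> K)" by blast
  then obtain K where "\<forall>T\<in>\<T>. 0 \<le> K T \<and> (\<forall>x\<in>T. norm (H T x) \<le> K T)"
    by (rule bchoice[THEN exE])
  then have K: "\<And>T. T \<in> \<T> \<Longrightarrow> 0 \<le> K T" "\<And>T x. T \<in> \<T> \<Longrightarrow> x \<in> T \<Longrightarrow> norm (H T x) \<le> K T"
    by auto
  have "AE x in lebesgue_on \<Omega>. norm (F x) \<le> sum K \<T>"
    using AE_interior
  proof eventually_elim
    case (elim x)
    then obtain T where T: "T \<in> \<T>" "x \<in> interior T" by blast
    then have "norm (F x) \<le> K T"
      using H(2) K(2) interior_subset by fastforce
    also have "\<dots> \<le> sum K \<T>"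
      using T(1) finite_\<T> K(1) by (intro member_le_sum) auto
    finally show ?case .
  qed
  then show "\<exists>K. AE x in lebesgue_on \<Omega>. norm (F x) \<le> K" by blast
qed

lemma P1_piecewise:
  assumes "v \<in> P1 \<T>" "T \<in> \<T>"
  shows "\<exists>h. continuous_on UNIV h \<and> (\<forall>x\<in>interior T. v x = h x)"
    and "\<exists>h. continuous_on UNIV h \<and> (\<forall>x\<in>interior T. grad v x = h x)"
proof -
  obtain a c where v: "\<forall>x\<in>interior T. v x = a \<bullet> x + c"
    using assms unfolding P1_def by blast
  then show "\<exists>h. continuous_on UNIV h \<and> (\<forall>x\<in>interior T. v x = h x)"
    by (intro exI[of _ "\<lambda>x. a \<bullet> x + c"]) (auto intro!: continuous_intros)
  have "grad v x = a" if "x \<in> interior T" for x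
    using grad_affine_on_open[OF open_interior that] v by blast
  then show "\<exists>h. continuous_on UNIV h \<and> (\<forall>x\<in>interior T. grad v x = h x)"
    by (intro exI[of _ "\<lambda>x. a"]) auto
qed

lemma grad_add_mult:
  assumes "v \<in> P1 \<T>" "w \<in> P1 \<T>" "T \<in> \<T>" "x \<in> interior T"
  shows "grad (\<lambda>x. v x + c * w x) x = grad v x + c *\<^sub>R grad w x"
proof -
  obtain a b where v: "\<forall>x\<in>interior T. v x = a \<bullet> x + b"
    using assms(1,3) unfolding P1_def by blast
  obtain a' b' where w: "\<forall>x\<in>interior T. w x = a' \<bullet> x + b'"
    using assms(2,3) unfolding P1_def by blast
  have "grad v x = a" "grad w x = a'"
    using grad_affine_on_open[OF open_interior assms(4)] v w by blast+
  moreover have "grad (\<lambda>x. v x + c * w x) x = a + c *\<^sub>R a'"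
    by (rule grad_affine_on_open[OF open_interior assms(4), of _ _ "b + c * b'"])
      (use v w in \<open>simp add: algebra_simps\<close>)
  ultimately show ?thesis by simp
qed

lemmas P1_measurable = piecewise_continuous_measurable[OF P1_piecewise(1)]
  and grad_P1_measurable = piecewise_continuous_measurable[OF P1_piecewise(2)]
  and P1_bounded = piecewise_continuous_bounded[OF P1_piecewise(1)]
  and grad_P1_bounded = piecewise_continuous_bounded[OF P1_piecewise(2)]

lemma P1_integrable:
  assumes "v \<in> P1 \<T>"
  shows "integrable (lebesgue_on \<Omega>) v" "integrable (lebesgue_on \<Omega>) (grad v)"
proof -
  obtain K where "AE x in lebesgue_on \<Omega>. norm (v x) \<le> K" using P1_bounded[OF assms] by blast
  then show "integrable (lebesgue_on \<Omega>) v"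
    by (rule finite_measure.integrable_const_bound[OF finite_measure_\<Omega> _ P1_measurable[OF assms]])
  obtain K where "AE x in lebesgue_on \<Omega>. norm (grad v x) \<le> K" using grad_P1_bounded[OF assms] by blast
  then show "integrable (lebesgue_on \<Omega>) (grad v)"
    by (rule finite_measure.integrable_const_bound[OF finite_measure_\<Omega> _ grad_P1_measurable[OF assms]])
qed

text \<open>One statement for all volume terms: \<open>p = v\<close>, \<open>q = grad v\<close>
  gives \<open>form_a\<close>, \<open>p = 0\<close> the flux term and \<open>q = 0\<close> the
  load.\<close>

lemma linear_on_P1_integral:
  fixes p :: "'a \<Rightarrow> real" and q :: "'a \<Rightarrow> 'a"
  assumes p: "integrable (lebesgue_on \<Omega>) p" and q: "integrable (lebesgue_on \<Omega>) q"
  shows "linear_on_P1 (\<lambda>v. LINT x|lebesgue_on \<Omega>. p x * v x + q x \<bullet> grad v x)"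
  unfolding linear_on_P1_def
proof (intro ballI allI)
  fix v w c assume v: "v \<in> P1 \<T>" and w: "w \<in> P1 \<T>"
  have int: "integrable (lebesgue_on \<Omega>) (\<lambda>x. p x * v x + q x \<bullet> grad v x)" if v: "v \<in> P1 \<T>" for v
  proof (rule Bochner_Integration.integrable_add)
    obtain K where K: "AE x in lebesgue_on \<Omega>. norm (v x) \<le> K" using P1_bounded[OF v] by blast
    show "integrable (lebesgue_on \<Omega>) (\<lambda>x. p x * v x)"
    proof (rule Bochner_Integration.integrable_bound)
      show "integrable (lebesgue_on \<Omega>) (\<lambda>x. K * norm (p x))" using p by simp
      show "(\<lambda>x. p x * v x) \<in> borel_measurable (lebesgue_on \<Omega>)"
        using p P1_measurable[OF v] by (intro borel_measurable_times) auto
      show "AE x in lebesgue_on \<Omega>. norm (p x * v x) \<le> norm (K * norm (p x))"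
        using K
      proof eventually_elim
        case (elim x)
        then have "\<bar>v x\<bar> * \<bar>p x\<bar> \<le> \<bar>K\<bar> * \<bar>p x\<bar>" by (intro mult_right_mono) auto
        then show ?case by (simp add: abs_mult mult.commute)
      qed
    qed
    obtain K where K: "AE x in lebesgue_on \<Omega>. norm (grad v x) \<le> K" using grad_P1_bounded[OF v] by blast
    show "integrable (lebesgue_on \<Omega>) (\<lambda>x. q x \<bullet> grad v x)"
    proof (rule Bochner_Integration.integrable_bound)
      show "integrable (lebesgue_on \<Omega>) (\<lambda>x. K * norm (q x))" using q by simp
      show "(\<lambda>x. q x \<bullet> grad v x) \<in> borel_measurable (lebesgue_on \<Omega>)"
        using q grad_P1_measurable[OF v] by (intro borel_measurable_inner) auto
      show "AE x in lebesgue_on \<Omega>. norm (q x \<bullet> grad v x) \<le> norm (K * norm (q x))"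
        using K
      proof eventually_elim
        case (elim x)
        have "\<bar>q x \<bullet> grad v x\<bar> \<le> norm (q x) * norm (grad v x)" by (rule Cauchy_Schwarz_ineq2)
        also have "\<dots> \<le> norm (q x) * \<bar>K\<bar>" using elim by (intro mult_left_mono) auto
        finally show ?case by (simp add: abs_mult mult.commute)
      qed
    qed
  qed
  let ?f = "\<lambda>v x. p x * v x + q x \<bullet> grad v x"
  let ?s = "\<lambda>x. v x + c * w x"
  have s: "?s \<in> P1 \<T>" using v w by (rule P1_add_mult)
  have "(LINT x|lebesgue_on \<Omega>. ?f ?s x) = (LINT x|lebesgue_on \<Omega>. ?f v x + c * ?f w x)"
  proof (rule integral_cong_AE)
    show "?f ?s \<in> borel_measurable (lebesgue_on \<Omega>)" using int[OF s] by (rule borel_measurable_integrable)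
    show "(\<lambda>x. ?f v x + c * ?f w x) \<in> borel_measurable (lebesgue_on \<Omega>)"
      by (intro borel_measurable_integrable Bochner_Integration.integrable_add
          integrable_mult_right int v w)
    show "AE x in lebesgue_on \<Omega>. ?f ?s x = ?f v x + c * ?f w x"
      using AE_interior
    proof eventually_elim
      case (elim x)
      then obtain T where "T \<in> \<T>" "x \<in> interior T" by blast
      from grad_add_mult[OF v w this] show ?case by (simp add: inner_add_right algebra_simps)
    qed
  qed
  also have "\<dots> = (LINT x|lebesgue_on \<Omega>. ?f v x) + c * (LINT x|lebesgue_on \<Omega>. ?f w x)"
    using int[OF v] int[OF w] by (subst Bochner_Integration.integral_add) auto
  finally show "(LINT x|lebesgue_on \<Omega>. ?f ?s x)
      = (LINT x|lebesgue_on \<Omega>. ?f v x) + c * (LINT x|lebesgue_on \<Omega>. ?f w x)" .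
qed

lemma L2_integrable: "u \<in> L2 \<Omega> \<Longrightarrow> integrable (lebesgue_on \<Omega>) u"
  unfolding L2_def
  using finite_measure.integrable_if_square_integrable[OF finite_measure_\<Omega>] by blast

text \<open>The flux is at most \<open>\<gamma>\<close> times the weak gradient in norm, and square
  integrable functions are integrable on a bounded domain.\<close>

lemma flux_integrable:
  assumes u: "u \<in> S10 \<Omega> \<T>" and cont: "continuous_on UNIV (flux \<phi> :: 'a \<Rightarrow> 'a)"
    and bound: "\<And>t. 0 \<le> t \<Longrightarrow> \<bar>\<phi> t\<bar> \<le> \<gamma>"
  shows "integrable (lebesgue_on \<Omega>) (\<lambda>x. flux \<phi> (weak_grad \<Omega> u x))"
proof -
  \<comment> \<open>Membership in \<open>H10\<close> supplies a witness, so the choice in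
    \<open>weak_grad\<close> returns a genuine weak gradient.\<close>
  obtain g where "has_weak_grad \<Omega> u g" using u unfolding S10_def H10_def by blast
  then have "has_weak_grad \<Omega> u (weak_grad \<Omega> u)"
    unfolding weak_grad_def by (rule someI[of "has_weak_grad \<Omega> u"])
  then have "weak_grad \<Omega> u \<in> L2 \<Omega>" unfolding has_weak_grad_def by blast
  then have wg: "integrable (lebesgue_on \<Omega>) (weak_grad \<Omega> u)" by (rule L2_integrable)
  show ?thesis
  proof (rule Bochner_Integration.integrable_bound)
    show "integrable (lebesgue_on \<Omega>) (\<lambda>x. \<gamma> * norm (weak_grad \<Omega> u x))" using wg by simp
    show "(\<lambda>x. flux \<phi> (weak_grad \<Omega> u x)) \<in> borel_measurable (lebesgue_on \<Omega>)"
      using borel_measurable_continuous_onI[OF cont] borel_measurable_integrable[OF wg]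
      by (rule measurable_compose[rotated])
    show "AE x in lebesgue_on \<Omega>. norm (flux \<phi> (weak_grad \<Omega> u x)) \<le> norm (\<gamma> * norm (weak_grad \<Omega> u x))"
    proof (rule AE_I2)
      fix x
      have "\<bar>\<phi> (norm (weak_grad \<Omega> u x))\<bar> \<le> \<bar>\<gamma>\<bar>"
        using bound[of "norm (weak_grad \<Omega> u x)"] by simp
      then show "norm (flux \<phi> (weak_grad \<Omega> u x)) \<le> norm (\<gamma> * norm (weak_grad \<Omega> u x))"
        by (simp add: flux_def abs_mult mult_right_mono)
    qed
  qed
qed

section \<open>Passage between the mixed and the reduced problem\<close>

lemma mixed_imp_reduced:
  assumes mixed: "solves_mixed \<Omega> \<T> \<nu> \<phi> f u t v"
  shows "v \<in> CR10 \<Omega> \<T>" "solves_reduced \<Omega> \<T> \<phi> f u v"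
proof -
  have u: "u \<in> S10 \<Omega> \<T>" and t: "t \<in> P0_sides \<T>" and v: "v \<in> P1 \<T>"
    and eq1: "\<And>\<eta>. \<eta> \<in> P1 \<T> \<Longrightarrow> form_a \<Omega> v \<eta> + form_b \<Omega> \<T> \<nu> \<phi> u t \<eta> = load \<Omega> f \<eta>"
    and eq2: "\<And>w s. w \<in> S10 \<Omega> \<T> \<Longrightarrow> s \<in> P0_sides \<T> \<Longrightarrow> form_b' \<Omega> \<T> \<nu> \<phi> u t w s v = 0"
    using mixed unfolding solves_mixed_def by auto
  let ?z = "\<lambda>E\<in>sides \<T>. 0 :: real"
  have z: "?z \<in> P0_sides \<T>" by (simp add: P0_sides_def)
  have pz: "skeleton_pairing \<T> \<nu> ?z v = 0" by (simp add: skeleton_pairing_eq[OF v])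
  have int: "(LINT x|lebesgue_on \<Omega>. weak_grad \<Omega> w x \<bullet> Dflux \<phi> (weak_grad \<Omega> u x) (grad v x)) = 0"
    if "w \<in> S10 \<Omega> \<T>" for w
    using eq2[OF that z] pz by (simp add: form_b'_def)
  \<comment> \<open>The volume term vanishes for every admissible \<open>w\<close>, so
    \<open>w = u\<close> isolates the pairing. This avoids showing that 0 lies in \<open>S10\<close>
    and that its chosen weak gradient vanishes almost everywhere.\<close>
  have "skeleton_pairing \<T> \<nu> s v = 0" if "s \<in> P0_sides \<T>" for s
    using eq2[OF u that] int[OF u] by (simp add: form_b'_def)
  then show CR: "v \<in> CR10 \<Omega> \<T>" by (rule CR10_if_pairing_zero[OF v])
  have "form_a \<Omega> v w + (LINT x|lebesgue_on \<Omega>. flux \<phi> (weak_grad \<Omega> u x) \<bullet> grad w x)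
      = (LINT x|lebesgue_on \<Omega>. f x * w x)" if w: "w \<in> CR10 \<Omega> \<T>" for w
  proof -
    have "w \<in> P1 \<T>" using w unfolding CR10_def by blast
    from eq1[OF this] show ?thesis
      by (simp add: form_b_def load_def pairing_CR10[OF w])
  qed
  then show "solves_reduced \<Omega> \<T> \<phi> f u v"
    unfolding solves_reduced_def using u CR int by blast
qed

lemma reduced_imp_unique_mixed:
  assumes reduced: "solves_reduced \<Omega> \<T> \<phi> f u v"
    and f: "f \<in> L2 \<Omega>"
    and cont: "continuous_on UNIV (flux \<phi> :: 'a \<Rightarrow> 'a)"
    and bound: "\<And>t. 0 \<le> t \<Longrightarrow> \<bar>\<phi> t\<bar> \<le> \<gamma>"
  shows "\<exists>!t. t \<in> P0_sides \<T> \<and> solves_mixed \<Omega> \<T> \<nu> \<phi> f u t v"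
proof -
  have u: "u \<in> S10 \<Omega> \<T>" and CR: "v \<in> CR10 \<Omega> \<T>"
    and eq1: "\<And>w. w \<in> CR10 \<Omega> \<T> \<Longrightarrow> form_a \<Omega> v w +
        (LINT x|lebesgue_on \<Omega>. flux \<phi> (weak_grad \<Omega> u x) \<bullet> grad w x)
          = (LINT x|lebesgue_on \<Omega>. f x * w x)"
    and eq2: "\<And>w. w \<in> S10 \<Omega> \<T> \<Longrightarrow>
        (LINT x|lebesgue_on \<Omega>. weak_grad \<Omega> w x \<bullet> Dflux \<phi> (weak_grad \<Omega> u x) (grad v x)) = 0"
    using reduced unfolding solves_reduced_def by auto
  have v: "v \<in> P1 \<T>" using CR unfolding CR10_def by blast
  \<comment> \<open>The residual of the first equation without the pairing; the reduced problem says
    that it vanishes on \<open>CR10\<close>.\<close>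
  define G where "G \<eta> = form_a \<Omega> v \<eta> +
      (LINT x|lebesgue_on \<Omega>. flux \<phi> (weak_grad \<Omega> u x) \<bullet> grad \<eta> x) - load \<Omega> f \<eta>" for \<eta>
  have "linear_on_P1 (form_a \<Omega> v)"
    using linear_on_P1_integral[OF P1_integrable[OF v]] by (simp add: form_a_def[abs_def])
  moreover have "linear_on_P1 (\<lambda>\<eta>. LINT x|lebesgue_on \<Omega>. flux \<phi> (weak_grad \<Omega> u x) \<bullet> grad \<eta> x)"
    using linear_on_P1_integral[OF integrable_zero flux_integrable[OF u cont bound]] by simp
  moreover have "linear_on_P1 (load \<Omega> f)"
    using linear_on_P1_integral[OF L2_integrable[OF f] integrable_zero] by (simp add: load_def[abs_def])
  ultimately have "linear_on_P1 G"
    unfolding linear_on_P1_def G_def by (simp add: algebra_simps)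
  moreover have "G w = 0" if "w \<in> CR10 \<Omega> \<T>" for w
    using eq1[OF that] by (simp add: G_def load_def)
  ultimately have "\<exists>!t. t \<in> P0_sides \<T> \<and> (\<forall>\<eta>\<in>P1 \<T>. skeleton_pairing \<T> \<nu> t \<eta> = G \<eta>)"
    by (rule pairing_representation)
  moreover have "solves_mixed \<Omega> \<T> \<nu> \<phi> f u t v \<longleftrightarrow> (\<forall>\<eta>\<in>P1 \<T>. skeleton_pairing \<T> \<nu> t \<eta> = G \<eta>)"
    if "t \<in> P0_sides \<T>" for t
  proof -
    \<comment> \<open>The second mixed equation holds for every \<open>t\<close>, because
      \<open>v\<close> annihilates all pairings; only the first one determines
      \<open>t\<close>.\<close>
    have "form_b' \<Omega> \<T> \<nu> \<phi> u t w s v = 0" if "w \<in> S10 \<Omega> \<T>" for w s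
      using eq2[OF that] by (simp add: form_b'_def pairing_CR10[OF CR])
    moreover have "form_a \<Omega> v \<eta> + form_b \<Omega> \<T> \<nu> \<phi> u t \<eta> = load \<Omega> f \<eta>
        \<longleftrightarrow> skeleton_pairing \<T> \<nu> t \<eta> = G \<eta>" for \<eta>
      by (auto simp: form_b_def G_def)
    ultimately show ?thesis
      unfolding solves_mixed_def using u that v by blast
  qed
  ultimately show ?thesis by metis
qed

end

theorem theorem3p9:
  fixes \<Omega> :: "'a::euclidean_space set"
    and \<T> :: "'a set set"
    and \<nu> :: "'a set \<Rightarrow> 'a"
    and \<phi> :: "real \<Rightarrow> real"
    and \<gamma>1 \<gamma>2 :: real
    and f :: "'a \<Rightarrow> real"
  assumes "bounded \<Omega>" and "lipschitz_domain \<Omega>" and "polyhedral_boundary \<Omega>"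
    and "triangulation_of \<T> \<Omega>" and "side_normals \<T> \<nu>"
    and "continuous_on {0..} \<phi>" and "C2_pos \<phi>"
    and "0 < \<gamma>1" and "\<gamma>1 \<le> \<gamma>2"
    and "\<forall>t\<ge>0. \<gamma>1 \<le> \<phi> t \<and> \<phi> t \<le> \<gamma>2"
    and "\<forall>t>0. \<gamma>1 \<le> \<phi> t + t * deriv \<phi> t \<and> \<phi> t + t * deriv \<phi> t \<le> \<gamma>2"
    and "\<exists>D :: 'a \<Rightarrow> 'a \<Rightarrow>\<^sub>L 'a. continuous_on UNIV D \<and>
           (\<forall>A. (flux \<phi> has_derivative blinfun_apply (D A)) (at A)
                \<and> blinfun_apply (D A) = Dflux \<phi> A)"
    and "f \<in> L2 \<Omega>"
  shows "(\<forall>u t v. solves_mixed \<Omega> \<T> \<nu> \<phi> f u t v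
            \<longrightarrow> v \<in> CR10 \<Omega> \<T> \<and> solves_reduced \<Omega> \<T> \<phi> f u v) \<and>
         (\<forall>u v. solves_reduced \<Omega> \<T> \<phi> f u v
            \<longrightarrow> (\<exists>!t. t \<in> P0_sides \<T> \<and> solves_mixed \<Omega> \<T> \<nu> \<phi> f u t v))"
proof -
  interpret bounded_mesh \<Omega> \<T> \<nu>
    using assms(1,2,4,5) by unfold_locales
  have "isCont (flux \<phi> :: 'a \<Rightarrow> 'a) A" for A
    using assms(12) has_derivative_continuous by blast
  then have cont: "continuous_on UNIV (flux \<phi> :: 'a \<Rightarrow> 'a)"
    by (simp add: continuous_at_imp_continuous_on)
  have bound: "\<bar>\<phi> t\<bar> \<le> \<gamma>2" if "0 \<le> t" for t
    using assms(8,10) that by fastforce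
  show ?thesis
    using mixed_imp_reduced reduced_imp_unique_mixed[OF _ assms(13) cont bound] by blast
qed

end
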